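(* Let $\rho>1$ be a real number and define $$u_\rho=\lceil\rho(\rho-1)\rceil,\qquad v_\rho=\left\lceil\frac{\rho^3}{\rho+1}\right\rceil,\qquad M_\rho=\min\{2u_\rho+1,\,2v_\rho\}.$$ Let $M\ge M_\rho$ be an integer, and suppose that $A\subseteq\mathbb{N}$ satisfies $$\sum_{a\in A}\|a\theta\|=\infty\qquad\text{for all }\theta\in\mathbb{T}\setminus\{0\}$$ and the inequality $|A\cap(\rho^k,\rho^{k+1}]|\ge M$ for every sufficiently large integer $k$. Then $$\lim_{n\to\infty}\frac{q_{A\setminus F}(n)}{n^{(M-M_\rho)\log_\rho 2}}=\infty$$ for every finite subset $F\subseteq A$. In particular, $A$ is strongly complete.
   Context: $\mathbb{N}=\{1,2,3,\ldots\}$ and $\mathbb{T}=\mathbb{R}/\mathbb{Z}$. For $x\in\mathbb{R}$ (or $x\in\mathbb{T}$), $\|x\|$ denotes the distance from $x$ to the nearest integer; for an integer $a$ and $\theta\in\mathbb{T}$, $\|a\theta\|$ is well defined. $\log_\rho 2=\log 2/\log\rho$. For $A\subseteq\mathbb{N}$, $q_A(n)$ is the number of representations of $n$ as a sum of distinct elements of $A$ (i.e. the number of finite subsets of $A$ whose elements sum to $n$). A set $A\subseteq\mathbb{N}$ is complete if every sufficiently large positive integer is a sum of distinct elements of $A$, and strongly complete if $A\setminus B$ is complete for every finite subset $B\subseteq A$. *)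

theory Defs
  imports "HOL-Analysis.Analysis"
begin

definition int_dist :: "real \<Rightarrow> real" where
  "int_dist x = infdist x \<int>"

(* Meaningful when 0 is not in A: then the collection counted is finite. *)
definition rep_count :: "nat set \<Rightarrow> nat \<Rightarrow> nat" where
  "rep_count A n = card {S. S \<subseteq> A \<and> finite S \<and> \<Sum>S = n}"

definition sum_complete :: "nat set \<Rightarrow> bool" where
  "sum_complete A \<longleftrightarrow>
     (\<forall>\<^sub>F n in sequentially. \<exists>S. S \<subseteq> A \<and> finite S \<and> \<Sum>S = n)"

definition strongly_sum_complete :: "nat set \<Rightarrow> bool" where
  "strongly_sum_complete A \<longleftrightarrow>
     (\<forall>B. B \<subseteq> A \<longrightarrow> finite B \<longrightarrow> sum_complete (A - B))"

definition u_const :: "real \<Rightarrow> int" where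
  "u_const \<rho> = \<lceil>\<rho> * (\<rho> - 1)\<rceil>"

definition v_const :: "real \<Rightarrow> int" where
  "v_const \<rho> = \<lceil>\<rho> ^ 3 / (\<rho> + 1)\<rceil>"

definition M_const :: "real \<Rightarrow> int" where
  "M_const \<rho> = min (2 * u_const \<rho> + 1) (2 * v_const \<rho>)"

(* The nonzero points of the circle R/Z are represented by the real numbers
   that are not integers; the norm of a * theta depends only on the class of
   theta because a is an integer. The sum is taken in [0, infinity], where it
   always exists. *)
definition circle_divergent :: "nat set \<Rightarrow> bool" where
  "circle_divergent A \<longleftrightarrow>
     (\<forall>\<theta>::real. \<theta> \<notin> \<int> \<longrightarrow> (\<Sum>\<^sub>\<infinity>a\<in>A. ennreal (int_dist (real a * \<theta>))) = \<infinity>)"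

end

theory Submission
  imports Defs
begin

text \<open>
Cut \<open>A\<close> into the blocks \<open>A \<inter> (\<rho>^k, \<rho>^(k+1)]\<close>. The theorem follows from writing every large
\<open>n\<close> as \<open>x + y + f\<close>, where \<open>x\<close>, \<open>y\<close>, \<open>f\<close> are subset sums of three disjoint subsets \<open>X\<close>, \<open>Y\<close>,
\<open>F\<close> of \<open>A\<close> with \<open>F\<close> finite, in such a way that \<open>M - M_const \<rho> + 1\<close> elements of every late block
remain unused. Each subset of the unused elements up to a small multiple of \<open>n\<close> can be completed to
a representation of \<open>n\<close>. There are about \<open>(M - M_const \<rho> + 1) log_\<rho> n\<close> such elements, hence at
least a constant times \<open>n powr ((M - M_const \<rho> + 1) * log \<rho> 2)\<close> representations, which exceeds
the claimed order by the factor \<open>n powr log \<rho> 2\<close>.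

The sets \<open>X\<close> and \<open>Y\<close> have \<open>p k\<close> and \<open>q k\<close> elements in the \<open>k\<close>-th block, where
\<open>p k + q k + 1 = M_const \<rho>\<close>; this is where the constant comes from
(\<open>dense_pattern_exists\<close>). With these numbers each element is at most the sum of the
elements in the earlier blocks plus a constant \<open>L\<close>, so the subset sums of \<open>X\<close>, and those of
\<open>Y\<close>, meet every window of length \<open>L\<close> (\<open>covers_subset_sums_of_blocks\<close>). The constant \<open>L\<close> depends on
\<open>\<rho>\<close> and on the first block, but not on the choice of the elements. So \<open>F\<close> may be chosen after
\<open>L\<close>, and \<open>X\<close> and \<open>Y\<close> after \<open>F\<close>, provided \<open>F\<close> leaves at least \<open>M - 1\<close> elements in each block.

The number of solutions of \<open>x + y + f = n\<close> is counted by Fourier analysis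
(\<open>ternary_circle_method\<close>). If the exponential sum over the values of \<open>f\<close> is small at
all frequencies \<open>\<theta>\<close> outside a small neighbourhood of the integers, then replacing \<open>n\<close> by the average
over the window \<open>(n - L, n]\<close> changes the count little, and the average is large because of the
covering property. To make the exponential sum small, \<open>F\<close> is a disjoint union of sets
\<open>S\<close>, called units, and \<open>f\<close> runs over the sums of the unions of units. The exponential sum is then
a product with one factor \<open>2 * cos (pi * \<Sum>S * \<theta>)\<close>, up to a number of modulus one, for each unit. So it
suffices that each \<open>\<theta>\<close> in a compact interval away from the integers has many units \<open>S\<close> for which
\<open>\<Sum>S * \<theta>\<close> is far from the integers.

For one \<open>\<theta>\<close> the divergence hypothesis provides such an \<open>S\<close> arbitrarily far out
(\<open>subset_sum_far_from_integers\<close>), and it still works near \<open>\<theta>\<close>. This does not settle all \<open>\<theta>\<close>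
at once: the neighbourhood depends on how far out \<open>S\<close> lies, and the units for different \<open>\<theta>\<close> compete
for the few spare elements of the blocks. The remedy is to take in addition one element \<open>c k\<close> from
every pair of consecutive blocks as a unit. If \<open>c i * \<theta>\<close> is near an integer for all
\<open>i < k\<close>, then \<open>\<theta>\<close> lies in one of boundedly many sets of diameter \<open>O(\<rho>^(-2k))\<close>. The bound
does not grow with \<open>k\<close>, because a small set of candidates stays a single small set when the next
\<open>c k\<close> is imposed (\<open>track_width_shrinks\<close>). Each of these nested sets shrinks to at most one frequency, which is
then treated with one unit \<open>S\<close>, one set after the other
(\<open>small_set_resolvable\<close>, \<open>finitely_many_small_sets_resolvable\<close>). Of each pair of blocks one
is used for \<open>c k\<close> and the other for \<open>S\<close>, so that they do not compete. A colouring of \<open>A\<close>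
with \<open>M\<close> colours, all of which occur in each late block, controls how much of a block is
used: \<open>F\<close> has a single colour in each block and hence leaves at least \<open>M - 1\<close> elements.
\<close>

section \<open>Distance to the nearest integer\<close>

lemma int_dist_nonneg: "0 \<le> int_dist x"
  by (simp add: int_dist_def infdist_nonneg)

lemma int_dist_le: "int_dist x \<le> \<bar>x - of_int m\<bar>"
  unfolding int_dist_def by (rule infdist_le2[of "of_int m"]) (auto simp: dist_real_def)

lemma int_dist_attained: obtains m :: int where "int_dist x = \<bar>x - of_int m\<bar>"
proof -
  obtain y where "y \<in> \<int>" "infdist x \<int> = dist x y"
    using infdist_attains_inf[of "\<int> :: real set" x] closed_Ints Ints_0 by blast
  with that show thesis by (auto simp: int_dist_def dist_real_def elim!: Ints_cases)
qed

lemma int_dist_geI: "(\<And>m::int. c \<le> \<bar>x - of_int m\<bar>) \<Longrightarrow> c \<le> int_dist x"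
  by (metis int_dist_attained)

lemma int_dist_le_half: "int_dist x \<le> 1/2"
proof -
  have "\<bar>x - of_int (round x)\<bar> \<le> 1/2" using of_int_round_abs_le[of x] by (simp add: abs_minus_commute)
  then show ?thesis using int_dist_le[of x "round x"] by linarith
qed

lemma int_dist_lipschitz: "\<bar>int_dist x - int_dist y\<bar> \<le> \<bar>x - y\<bar>"
  using infdist_triangle_abs[of x \<int> y] by (simp add: int_dist_def dist_real_def)

lemma continuous_on_int_dist [continuous_intros]:
  "continuous_on S f \<Longrightarrow> continuous_on S (\<lambda>x. int_dist (f x))"
  unfolding int_dist_def by (rule continuous_on_infdist)

section \<open>Exponential sums\<close>

definition circle_char :: "real \<Rightarrow> complex" where
  "circle_char x = cis (2 * pi * x)"

lemma circle_char_add: "circle_char (x + y) = circle_char x * circle_char y"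
  by (simp add: circle_char_def cis_mult ring_distribs)

lemma norm_circle_char [simp]: "norm (circle_char x) = 1"
  by (simp add: circle_char_def)

lemma circle_char_of_int [simp]: "circle_char (of_int m) = 1"
  by (simp add: circle_char_def)

lemma circle_char_0 [simp]: "circle_char 0 = 1"
  by (simp add: circle_char_def)

lemma circle_char_diff_int: "circle_char (x - of_int m) = circle_char x"
  using circle_char_add[of "x - of_int m" "of_int m"] by simp

lemma cnj_circle_char: "cnj (circle_char x) = circle_char (- x)"
  by (simp add: circle_char_def cis_cnj)

lemma circle_char_power: "circle_char x ^ n = circle_char (real n * x)"
  by (induction n) (simp_all add: distrib_right circle_char_add)

lemma circle_char_eq_1: "circle_char x = 1 \<Longrightarrow> x \<in> \<int>"
proof -
  assume "circle_char x = 1"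
  then have "cos (2 * pi * x) = 1" by (simp add: circle_char_def complex_eq_iff)
  then obtain m :: int where "2 * pi * x = of_int m * 2 * pi"
    by (auto simp: cos_one_2pi_int)
  then have "x = of_int m" by simp
  then show ?thesis by simp
qed

lemma norm_1_plus_circle_char: "norm (1 + circle_char x) = 2 * \<bar>cos (pi * x)\<bar>"
proof -
  have "1 + circle_char x = circle_char (x/2) * (circle_char (x/2) + circle_char (-(x/2)))"
    by (simp add: distrib_left flip: circle_char_add)
  also have "circle_char (x/2) + circle_char (-(x/2)) = of_real (2 * cos (pi * x))"
    by (simp add: circle_char_def complex_eq_iff)
  finally show ?thesis by (simp add: norm_mult)
qed

lemma norm_circle_char_minus_1: "norm (circle_char x - 1) \<le> 2 * pi * \<bar>x - of_int m\<bar>"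
proof -
  have "norm (circle_char y - 1) \<le> 2 * pi * \<bar>y\<bar>" for y
  proof -
    have "circle_char y - 1 = circle_char (y/2) * (circle_char (y/2) - circle_char (-(y/2)))"
      by (simp add: right_diff_distrib flip: circle_char_add)
    also have "circle_char (y/2) - circle_char (-(y/2)) = of_real (2 * sin (pi * y)) * \<i>"
      by (simp add: circle_char_def complex_eq_iff)
    finally have "norm (circle_char y - 1) = 2 * \<bar>sin (pi * y)\<bar>" by (simp add: norm_mult)
    also have "\<bar>sin (pi * y)\<bar> \<le> \<bar>pi * y\<bar>" by (rule abs_sin_x_le_abs_x)
    finally show ?thesis by (simp add: abs_mult)
  qed
  from this[of "x - of_int m"] show ?thesis by (simp add: circle_char_diff_int)
qed

lemma circle_char_orthogonality:
  assumes "N > 0"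
  shows "(\<Sum>\<xi><N. circle_char (of_int m * (real \<xi> / real N))) = (if int N dvd m then of_nat N else 0)"
proof (cases "int N dvd m")
  case True
  then obtain q where "m = int N * q" by (auto elim: dvdE)
  then have "circle_char (of_int m * (real \<xi> / real N)) = 1" for \<xi>
    using assms circle_char_of_int[of "q * int \<xi>"] by simp
  with True show ?thesis by simp
next
  case False
  define w where "w = circle_char (of_int m / real N)"
  have "w \<noteq> 1"
  proof
    assume "w = 1"
    then have "of_int m / real N \<in> \<int>" unfolding w_def by (rule circle_char_eq_1)
    then obtain q where "of_int m / real N = of_int q" by (auto elim: Ints_cases)
    then have "real_of_int m = of_int (q * int N)" using assms by (simp add: field_simps)
    then have "m = q * int N" by linarith
    with False show False by simp
  qed
  moreover have "w ^ N = 1" using assms by (simp add: w_def circle_char_power)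
  ultimately have "(\<Sum>\<xi><N. w ^ \<xi>) = 0" by (simp add: sum_gp_strict)
  moreover have "w ^ \<xi> = circle_char (of_int m * (real \<xi> / real N))" for \<xi>
    by (simp add: w_def circle_char_power mult.commute)
  ultimately show ?thesis using False by simp
qed

lemma sum_circle_char_count:
  fixes h :: "'a \<Rightarrow> int"
  assumes "N > 0" "finite T" "\<And>t. t \<in> T \<Longrightarrow> \<bar>h t\<bar> < int N"
  shows "(\<Sum>\<xi><N. \<Sum>t\<in>T. circle_char (of_int (h t) * (real \<xi> / real N)))
           = of_nat (N * card {t\<in>T. h t = 0})"
proof -
  have dvd: "int N dvd h t \<longleftrightarrow> h t = 0" if "t \<in> T" for t
    using assms(3)[OF that] zdvd_imp_le[of "int N" "\<bar>h t\<bar>"] by force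
  have "(\<Sum>\<xi><N. \<Sum>t\<in>T. circle_char (of_int (h t) * (real \<xi> / real N)))
      = (\<Sum>t\<in>T. \<Sum>\<xi><N. circle_char (of_int (h t) * (real \<xi> / real N)))"
    by (rule sum.swap)
  also have "\<dots> = (\<Sum>t\<in>T. if h t = 0 then of_nat N else 0)"
    using assms(1) dvd by (intro sum.cong refl) (simp only: circle_char_orthogonality)
  also have "\<dots> = of_nat N * of_nat (card {t\<in>T. h t = 0})"
    using assms(2) by (simp add: sum.If_cases Int_def)
  finally show ?thesis by simp
qed

definition exp_sum :: "'a set \<Rightarrow> ('a \<Rightarrow> nat) \<Rightarrow> real \<Rightarrow> complex" where
  "exp_sum T h \<theta> = (\<Sum>t\<in>T. circle_char (real (h t) * \<theta>))"

lemma norm_exp_sum_le: "norm (exp_sum T h \<theta>) \<le> real (card T)"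
  unfolding exp_sum_def by (rule sum_norm_le[THEN order_trans]) auto

lemma exp_sum_mult:
  "exp_sum S g \<theta> * exp_sum T h \<theta> = exp_sum (S \<times> T) (\<lambda>(s, t). g s + h t) \<theta>"
  by (simp add: exp_sum_def sum_product sum.cartesian_product case_prod_beta distrib_right circle_char_add)

text \<open>
Expanding the square of the modulus turns the average into a count of pairs \<open>(d, d')\<close> with
\<open>d - d'\<close> divisible by \<open>N\<close>, and such a pair is diagonal because all elements are below \<open>N\<close>.
\<close>
lemma parseval_exp_sum:
  assumes "N > 0" "finite D" "\<And>d. d \<in> D \<Longrightarrow> d < N"
  shows "(\<Sum>\<xi><N. (norm (exp_sum D id (real \<xi> / real N)))\<^sup>2) = real (N * card D)"
proof -
  have "complex_of_real ((norm (exp_sum D id \<theta>))\<^sup>2)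
      = (\<Sum>t\<in>D \<times> D. circle_char (of_int (int (fst t) - int (snd t)) * \<theta>))" for \<theta>
  proof -
    have "cnj (exp_sum D id \<theta>) = (\<Sum>t\<in>D. circle_char (- (real t * \<theta>)))"
      by (simp add: exp_sum_def cnj_circle_char)
    then show ?thesis
      unfolding complex_norm_square by (simp add: exp_sum_def sum_product sum.cartesian_product case_prod_beta
          left_diff_distrib flip: circle_char_add)
  qed
  then have "complex_of_real (\<Sum>\<xi><N. (norm (exp_sum D id (real \<xi> / real N)))\<^sup>2)
     = (\<Sum>\<xi><N. \<Sum>t\<in>D \<times> D. circle_char (of_int (int (fst t) - int (snd t)) * (real \<xi> / real N)))"
    by simp
  also have "\<dots> = of_nat (N * card {t\<in>D \<times> D. int (fst t) - int (snd t) = 0})"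
    using assms(1,2) by (intro sum_circle_char_count) (auto dest!: assms(3))
  also have "{t\<in>D \<times> D. int (fst t) - int (snd t) = 0} = (\<lambda>d. (d, d)) ` D" by auto
  also have "card \<dots> = card D" by (intro card_image) (auto simp: inj_on_def)
  finally show ?thesis by (metis of_real_eq_iff of_real_of_nat_eq)
qed

lemma exp_sum_shift:
  "exp_sum T h \<theta> * circle_char (- (real n * \<theta>)) = (\<Sum>t\<in>T. circle_char (of_int (int (h t) - int n) * \<theta>))"
  by (simp add: exp_sum_def sum_distrib_right left_diff_distrib flip: circle_char_add)

section \<open>The circle method for two covering sets and a third family\<close>

definition covers :: "nat \<Rightarrow> nat set \<Rightarrow> bool" where
  "covers L S \<longleftrightarrow> (\<forall>t. \<exists>s\<in>S. s \<le> t \<and> t < s + L)"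

text \<open>
Disjoint windows of length \<open>L\<close> contain different elements.
\<close>
lemma covers_card:
  assumes "covers L S"
  shows "(m + 1) div L \<le> card {s\<in>S. s \<le> m}"
proof -
  have "L > 0" using assms unfolding covers_def by (metis add_0_right not_gr_zero not_le)
  define pick where "pick j = (SOME s. s \<in> S \<and> s \<le> j * L + (L - 1) \<and> j * L + (L - 1) < s + L)" for j
  have pick: "pick j \<in> S \<and> pick j \<le> j * L + (L - 1) \<and> j * L + (L - 1) < pick j + L" for j
    unfolding pick_def by (rule someI_ex) (use assms in \<open>unfold covers_def, blast\<close>)
  have div: "pick j div L = j" for j
    using pick[of j] \<open>L > 0\<close> by (intro div_nat_eqI) (auto simp: algebra_simps)
  have "inj_on pick {..<(m + 1) div L}" by (intro inj_onI) (metis div)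
  moreover have "pick ` {..<(m + 1) div L} \<subseteq> {s\<in>S. s \<le> m}"
  proof safe
    fix j assume "j < (m + 1) div L"
    then have "(j + 1) * L \<le> m + 1" using \<open>L > 0\<close> by (metis Suc_eq_plus1 Suc_leI less_eq_div_iff_mult_less_eq)
    then show "pick j \<le> m" using pick[of j] \<open>L > 0\<close> by (auto simp: algebra_simps)
  qed (use pick in auto)
  moreover have "finite {s\<in>S. s \<le> m}" by simp
  ultimately have "card {..<(m + 1) div L} \<le> card {s\<in>S. s \<le> m}" by (rule card_inj_on_le)
  then show ?thesis by simp
qed

text \<open>
The exponential sum \<open>Q\<close> of the triples has total \<open>0\<close> over the \<open>N\<close>-th roots of unity if \<open>n\<close> is not
represented. Multiplying it by the kernel \<open>U\<close> of the window \<open>{..<L}\<close> counts the triples whose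
sum lies in \<open>(n - L, n]\<close>; as \<open>S2\<close> meets this window for all shifts, there are at least about \<open>n / L\<close> of them for
every \<open>i\<close>. The two totals, the first one multiplied by \<open>L\<close>, differ by the total of \<open>Q * (U - L)\<close>. This
is small: far from the integers the third factor of \<open>Q\<close> is small by hypothesis, near them \<open>U\<close> is close
to \<open>L\<close>, and the remaining two factors are bounded on average by Parseval. The powers of \<open>L\<close> in the
hypothesis are chosen so that this error is at most a quarter of the main term \<open>n / L\<close>.
\<close>
lemma ternary_circle_method:
  fixes S1 S2 :: "nat set" and g :: "'i \<Rightarrow> nat"
  assumes cov: "covers L S1" "covers L S2"
    and I: "finite I" "I \<noteq> {}" "\<And>i. i \<in> I \<Longrightarrow> g i \<le> G"
    and small: "\<And>\<theta>. 1 / (32 * real L ^ 3) \<le> \<theta> \<Longrightarrow> \<theta> \<le> 1 - 1 / (32 * real L ^ 3) \<Longrightarrow>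
                  norm (exp_sum I g \<theta>) \<le> real (card I) / (8 * (real L)\<^sup>2)"
    and n: "n \<ge> 2 * (G + L)"
  shows "\<exists>s1\<in>S1. \<exists>s2\<in>S2. \<exists>i\<in>I. s1 + s2 + g i = n"
proof (rule ccontr)
  assume none: "\<not> ?thesis"
  have "L > 0" using cov unfolding covers_def by (metis add_0_right not_gr_zero not_le)
  define D where "D = {s\<in>S1. s \<le> n}"
  define E where "E = {s\<in>S2. s \<le> n}"
  \<comment> \<open>All sums that occur lie strictly between \<open>-N\<close> and \<open>N\<close> after subtracting \<open>n\<close>, so congruence
    modulo \<open>N\<close> means equality.\<close>
  define N where "N = 3 * n + G + L + 1"
  define p :: "nat \<Rightarrow> real" where "p \<xi> = real \<xi> / real N" for \<xi>
  have fin: "finite D" "finite E" by (auto simp: D_def E_def)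
  have "N > 0" by (simp add: N_def)
  have cardI: "card I > 0" using I by (simp add: card_gt_0_iff)
  have cards: "card D \<le> n + 1" "card E \<le> n + 1"
    using card_mono[of "{..n}" D] card_mono[of "{..n}" E] by (auto simp: D_def E_def)
  define Q where "Q \<xi> = exp_sum D id (p \<xi>) * exp_sum E id (p \<xi>) * exp_sum I g (p \<xi>) * circle_char (- (real n * p \<xi>))" for \<xi>
  define U where "U \<xi> = exp_sum {..<L} id (p \<xi>)" for \<xi>
  define T0 where "T0 = (D \<times> E) \<times> I"
  define T1 where "T1 = ((D \<times> E) \<times> I) \<times> {..<L}"
  define h0 where "h0 = (\<lambda>((d, e), i). d + e + g i)"
  define h1 where "h1 = (\<lambda>(((d, e), i), l). d + e + g i + l)"
  have Q: "Q \<xi> = (\<Sum>t\<in>T0. circle_char (of_int (int (h0 t) - int n) * p \<xi>))" for \<xi>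
    unfolding Q_def exp_sum_mult exp_sum_shift T0_def h0_def by (simp add: case_prod_beta)
  have QU: "Q \<xi> * U \<xi> = (\<Sum>t\<in>T1. circle_char (of_int (int (h1 t) - int n) * p \<xi>))" for \<xi>
  proof -
    have "Q \<xi> * U \<xi> = exp_sum D id (p \<xi>) * exp_sum E id (p \<xi>) * exp_sum I g (p \<xi>) * exp_sum {..<L} id (p \<xi>) * circle_char (- (real n * p \<xi>))"
      by (simp add: Q_def U_def)
    then show ?thesis
      unfolding exp_sum_mult exp_sum_shift T1_def h1_def by (simp add: case_prod_beta)
  qed
  have gI: "int (g i) \<le> int G" if "i \<in> I" for i using I(3)[OF that] by simp
  have sumQ: "(\<Sum>\<xi><N. Q \<xi>) = 0"
  proof -
    have "(\<Sum>\<xi><N. Q \<xi>) = of_nat (N * card {t\<in>T0. int (h0 t) - int n = 0})"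
      unfolding Q p_def using \<open>N > 0\<close> fin I(1)
      by (intro sum_circle_char_count) (auto simp: T0_def h0_def D_def E_def N_def dest!: gI)
    also have "{t\<in>T0. int (h0 t) - int n = 0} = {}"
      using none by (fastforce simp: T0_def h0_def D_def E_def)
    finally show ?thesis by simp
  qed
  have sumQU: "real (N * card I * ((n - G + 1) div L)) \<le> norm (\<Sum>\<xi><N. Q \<xi> * U \<xi>)"
  proof -
    define D' where "D' = {s\<in>S1. s \<le> n - G}"
    define e where "e t = (SOME s. s \<in> S2 \<and> s \<le> t \<and> t < s + L)" for t
    have e: "e t \<in> S2 \<and> e t \<le> t \<and> t < e t + L" for t
      unfolding e_def by (rule someI_ex) (use cov(2) in \<open>unfold covers_def, blast\<close>)
    \<comment> \<open>Any \<open>d\<close> and \<open>i\<close> with \<open>d + g i \<le> n\<close> can be completed: the window below \<open>n - d - g i\<close> contains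
      an element of \<open>S2\<close>.\<close>
    define f where "f = (\<lambda>(d, i). (((d, e (n - d - g i)), i), n - d - g i - e (n - d - g i)))"
    have "inj_on f (D' \<times> I)" by (auto simp: inj_on_def f_def)
    moreover have "f ` (D' \<times> I) \<subseteq> {t\<in>T1. int (h1 t) - int n = 0}"
    proof
      fix t assume "t \<in> f ` (D' \<times> I)"
      then obtain d i where di: "d \<in> S1" "d \<le> n - G" "i \<in> I" "t = f (d, i)" by (auto simp: D'_def)
      have "d + g i \<le> n" using di I(3)[of i] n by simp
      then show "t \<in> {t\<in>T1. int (h1 t) - int n = 0}"
        using di e[of "n - d - g i"] by (auto simp: f_def T1_def h1_def D_def E_def)
    qed
    moreover have "finite {t\<in>T1. int (h1 t) - int n = 0}" using fin I(1) by (simp add: T1_def)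
    ultimately have "card (D' \<times> I) \<le> card {t\<in>T1. int (h1 t) - int n = 0}"
      by (rule card_inj_on_le)
    then have "card D' * card I \<le> card {t\<in>T1. int (h1 t) - int n = 0}"
      by (simp only: card_cartesian_product)
    moreover have "(n - G + 1) div L \<le> card D'" unfolding D'_def by (rule covers_card[OF cov(1)])
    then have "((n - G + 1) div L) * card I \<le> card D' * card I" by (rule mult_le_mono1)
    ultimately have "N * card I * ((n - G + 1) div L) \<le> N * card {t\<in>T1. int (h1 t) - int n = 0}"
      unfolding mult.assoc mult.commute[of "card I"] by (intro mult_le_mono2) linarith
    moreover have "(\<Sum>\<xi><N. Q \<xi> * U \<xi>) = of_nat (N * card {t\<in>T1. int (h1 t) - int n = 0})"
      unfolding QU p_def using \<open>N > 0\<close> fin I(1)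
      by (intro sum_circle_char_count) (auto simp: T1_def h1_def D_def E_def N_def dest!: gI)
    ultimately show ?thesis by (simp only: norm_of_nat of_nat_le_iff)
  qed
  define \<tau> where "\<tau> = real (card I) / (4 * real L)"
  have GU: "norm (exp_sum I g (p \<xi>)) * norm (U \<xi> - of_nat L) \<le> \<tau>" if "\<xi> < N" for \<xi>
  proof (cases "1 / (32 * real L ^ 3) \<le> p \<xi> \<and> p \<xi> \<le> 1 - 1 / (32 * real L ^ 3)")
    case True
    have "norm (U \<xi> - of_nat L) \<le> norm (U \<xi>) + norm (of_nat L :: complex)" by (rule norm_triangle_ineq4)
    also have "\<dots> \<le> 2 * real L" using norm_exp_sum_le[of "{..<L}" id "p \<xi>"] by (simp add: U_def)
    finally have "norm (exp_sum I g (p \<xi>)) * norm (U \<xi> - of_nat L) \<le> (real (card I) / (8 * (real L)\<^sup>2)) * (2 * real L)"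
      using small[of "p \<xi>"] True by (intro mult_mono) auto
    also have "\<dots> = \<tau>" using \<open>L > 0\<close> by (simp add: \<tau>_def power2_eq_square)
    finally show ?thesis .
  next
    case False
    have p01: "0 \<le> p \<xi>" "p \<xi> < 1" using that \<open>N > 0\<close> by (auto simp: p_def)
    define m :: int where "m = (if p \<xi> < 1 / (32 * real L ^ 3) then 0 else 1)"
    have m: "\<bar>p \<xi> - of_int m\<bar> \<le> 1 / (32 * real L ^ 3)" using False p01 by (auto simp: m_def)
    have "U \<xi> - of_nat L = (\<Sum>l<L. circle_char (real l * p \<xi>) - 1)"
      by (simp add: U_def exp_sum_def sum_subtractf)
    also have "norm \<dots> \<le> (\<Sum>l<L. 2 * pi * (real L * (1 / (32 * real L ^ 3))))"
    proof (intro sum_norm_le)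
      fix l assume l: "l \<in> {..<L}"
      have "norm (circle_char (real l * p \<xi>) - 1) \<le> 2 * pi * \<bar>real l * p \<xi> - of_int (int l * m)\<bar>"
        by (rule norm_circle_char_minus_1)
      also have "real l * p \<xi> - of_int (int l * m) = real l * (p \<xi> - of_int m)" by (simp add: algebra_simps)
      also have "\<bar>\<dots>\<bar> = real l * \<bar>p \<xi> - of_int m\<bar>" by (simp add: abs_mult)
      also have "\<dots> \<le> real L * (1 / (32 * real L ^ 3))" using l m by (intro mult_mono) auto
      finally show "norm (circle_char (real l * p \<xi>) - 1) \<le> 2 * pi * (real L * (1 / (32 * real L ^ 3)))"
        by simp
    qed
    also have "\<dots> = 2 * pi / (32 * real L)" using \<open>L > 0\<close> by (simp add: power3_eq_cube)
    also have "\<dots> \<le> 8 / (32 * real L)" using pi_less_4 by (intro divide_right_mono) auto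
    finally have "norm (exp_sum I g (p \<xi>)) * norm (U \<xi> - of_nat L) \<le> real (card I) * (8 / (32 * real L))"
      using norm_exp_sum_le[of I g "p \<xi>"] by (intro mult_mono) auto
    then show ?thesis by (simp add: \<tau>_def)
  qed
  have "norm (\<Sum>\<xi><N. Q \<xi> * U \<xi>) = norm (\<Sum>\<xi><N. Q \<xi> * (U \<xi> - of_nat L))"
    by (simp add: right_diff_distrib sum_subtractf sumQ flip: sum_distrib_right)
  also have "\<dots> \<le> (\<Sum>\<xi><N. \<tau> * (((norm (exp_sum D id (p \<xi>)))\<^sup>2 + (norm (exp_sum E id (p \<xi>)))\<^sup>2) / 2))"
  proof (intro sum_norm_le)
    fix \<xi> assume \<xi>: "\<xi> \<in> {..<N}"
    let ?x = "norm (exp_sum D id (p \<xi>))" and ?y = "norm (exp_sum E id (p \<xi>))"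
    have "norm (Q \<xi> * (U \<xi> - of_nat L)) = (norm (exp_sum I g (p \<xi>)) * norm (U \<xi> - of_nat L)) * (?x * ?y)"
      by (simp add: Q_def norm_mult)
    also have "\<dots> \<le> \<tau> * ((?x\<^sup>2 + ?y\<^sup>2) / 2)"
      using GU[of \<xi>] \<xi> sum_squares_bound[of ?x ?y] by (intro mult_mono) (auto simp: \<tau>_def)
    finally show "norm (Q \<xi> * (U \<xi> - of_nat L)) \<le> \<tau> * ((?x\<^sup>2 + ?y\<^sup>2) / 2)" .
  qed
  also have "\<dots> = \<tau> * ((real (N * card D) + real (N * card E)) / 2)"
  proof -
    have "\<And>d. d \<in> D \<Longrightarrow> d < N" "\<And>d. d \<in> E \<Longrightarrow> d < N" by (auto simp: D_def E_def N_def)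
    then have "(\<Sum>\<xi><N. (norm (exp_sum D id (p \<xi>)))\<^sup>2) = real (N * card D)"
      "(\<Sum>\<xi><N. (norm (exp_sum E id (p \<xi>)))\<^sup>2) = real (N * card E)"
      unfolding p_def using \<open>N > 0\<close> fin by (intro parseval_exp_sum; blast)+
    then show ?thesis by (simp add: sum.distrib flip: sum_distrib_left sum_divide_distrib)
  qed
  also have "\<dots> \<le> \<tau> * (real N * (real n + 1))"
  proof -
    have "real N * real (card D) \<le> real N * (real n + 1)" "real N * real (card E) \<le> real N * (real n + 1)"
      using cards by (intro mult_left_mono; simp)+
    then show ?thesis by (intro mult_left_mono) (auto simp: \<tau>_def)
  qed
  finally have "real (N * card I * ((n - G + 1) div L)) \<le> \<tau> * (real N * (real n + 1))"
    using sumQU by linarith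
  then have "(real N * real (card I)) * real ((n - G + 1) div L) \<le> (real N * real (card I)) * ((real n + 1) / (4 * real L))"
    by (simp add: \<tau>_def field_simps)
  then have "real ((n - G + 1) div L) \<le> (real n + 1) / (4 * real L)"
    by (rule mult_left_le_imp_le) (use \<open>N > 0\<close> cardI in simp)
  then have "4 * (real L * real ((n - G + 1) div L)) \<le> real n + 1"
    using \<open>L > 0\<close> by (simp add: field_simps)
  moreover define q where "q = L * ((n - G + 1) div L)"
  ultimately have "real (4 * q) \<le> real (n + 1)" by (simp add: algebra_simps)
  then have "4 * q \<le> n + 1" by (simp only: of_nat_le_iff)
  moreover obtain k where k: "n = G + k" using n by (metis le_Suc_ex add_leD1 mult_2)
  moreover have "k + 1 < q + L"
    using k dividend_less_times_div[OF \<open>L > 0\<close>, of "n - G + 1"] by (simp add: q_def)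
  ultimately show False using n by simp
qed

section \<open>Gaps between subset sums\<close>

definition subset_sums :: "nat set \<Rightarrow> nat set" where
  "subset_sums X = {\<Sum>S |S. finite S \<and> S \<subseteq> X}"

text \<open>
Adding one element \<open>b\<close> translates the subset sums by \<open>b\<close>. The translated sums start at \<open>b\<close>, which is
at most \<open>L\<close> beyond the end of the old ones, so no gap longer than \<open>L\<close> arises between the two ranges.
\<close>
lemma subset_gaps_Un:
  fixes V B :: "nat set"
  assumes "finite V" "finite B" "V \<inter> B = {}"
    and "\<forall>t < \<Sum>V + L. \<exists>S\<subseteq>V. \<Sum>S \<le> t \<and> t < \<Sum>S + L"
    and "\<forall>b\<in>B. b \<le> \<Sum>V + L"
  shows "\<forall>t < \<Sum>(V \<union> B) + L. \<exists>S\<subseteq>V \<union> B. \<Sum>S \<le> t \<and> t < \<Sum>S + L"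
  using assms(2,3,5)
proof (induction B rule: finite_induct)
  case empty
  with assms(4) show ?case by simp
next
  case (insert b B)
  let ?W = "V \<union> B"
  have IH: "\<forall>t < \<Sum>?W + L. \<exists>S\<subseteq>?W. \<Sum>S \<le> t \<and> t < \<Sum>S + L" using insert by auto
  have b: "b \<notin> ?W" "finite ?W" using insert assms(1) by auto
  have "\<Sum>V \<le> \<Sum>?W" using b by (intro sum_mono2) auto
  then have bW: "b \<le> \<Sum>?W + L" using insert by force
  have sum: "\<Sum>(V \<union> insert b B) = b + \<Sum>?W" using b by simp
  show ?case
  proof (intro allI impI)
    fix t assume t: "t < \<Sum>(V \<union> insert b B) + L"
    show "\<exists>S\<subseteq>V \<union> insert b B. \<Sum>S \<le> t \<and> t < \<Sum>S + L"
    proof (cases "t < \<Sum>?W + L")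
      case True
      then obtain S where "S \<subseteq> ?W" "\<Sum>S \<le> t \<and> t < \<Sum>S + L" using IH by blast
      then show ?thesis by blast
    next
      case False
      then have "b \<le> t" "t - b < \<Sum>?W + L" using bW t sum by auto
      then obtain S where S: "S \<subseteq> ?W" "\<Sum>S \<le> t - b" "t - b < \<Sum>S + L" using IH by blast
      then have "finite S" "b \<notin> S" using b finite_subset by blast+
      then have "\<Sum>(insert b S) = b + \<Sum>S" by simp
      with S \<open>b \<le> t\<close> have "insert b S \<subseteq> V \<union> insert b B \<and> \<Sum>(insert b S) \<le> t \<and> t < \<Sum>(insert b S) + L"
        by auto
      then show ?thesis by blast
    qed
  qed
qed

text \<open>
The bound \<open>big\<close> says that an element of block \<open>k\<close> is at most the sum of all earlier blocks plus \<open>L\<close>,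
so the blocks can be added one after the other without creating long gaps.
\<close>
lemma covers_subset_sums_of_blocks:
  fixes X :: "nat \<Rightarrow> nat set" and \<rho> :: real
  assumes "\<rho> > 1"
    and fin: "\<And>k. k \<ge> k0 \<Longrightarrow> finite (X k)"
    and mem: "\<And>k x. k \<ge> k0 \<Longrightarrow> x \<in> X k \<Longrightarrow> \<rho> ^ k < real x \<and> real x \<le> \<rho> ^ (k + 1)"
    and big: "\<And>k. k \<ge> k0 \<Longrightarrow> \<rho> ^ (k + 1) \<le> (\<Sum>j=k0..<k. real (\<Sum>(X j))) + real L"
  shows "covers L (subset_sums (\<Union>k\<in>{k0..}. X k))"
proof -
  define V where "V k = (\<Union>j\<in>{k0..<k}. X j)" for k
  have finV: "finite (V k)" for k using fin by (simp add: V_def)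
  have disj: "X i \<inter> X j = {}" if "k0 \<le> i" "i < j" for i j
  proof -
    have "\<rho> ^ (i + 1) \<le> \<rho> ^ j" using that assms(1) by (intro power_increasing) auto
    then show ?thesis using mem[of i] mem[of j] that by fastforce
  qed
  have sumV: "real (\<Sum>(V k)) = (\<Sum>j=k0..<k. real (\<Sum>(X j)))" for k
  proof -
    have "X i \<inter> X j = {}" if "k0 \<le> i" "k0 \<le> j" "i \<noteq> j" for i j
      using disj[of i j] disj[of j i] that by (cases "i < j") auto
    then have "\<Sum>(V k) = (\<Sum>j=k0..<k. \<Sum>(X j))" unfolding V_def
      by (intro sum.UNION_disjoint) (use fin in auto)
    then show ?thesis by simp
  qed
  have bigV: "\<rho> ^ (k + 1) \<le> real (\<Sum>(V k) + L)" if "k \<ge> k0" for k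
    using big[OF that] by (simp only: of_nat_add sumV)
  have gaps: "\<forall>t < \<Sum>(V k) + L. \<exists>S\<subseteq>V k. \<Sum>S \<le> t \<and> t < \<Sum>S + L" if "k \<ge> k0" for k
    using that
  proof (induction k rule: dec_induct)
    case base
    then show ?case by (auto simp: V_def)
  next
    case (step k)
    have "V (Suc k) = V k \<union> X k" using step by (auto simp: V_def less_Suc_eq)
    moreover have "V k \<inter> X k = {}" using disj[of _ k] by (auto simp: V_def disjoint_iff)
    moreover have "\<forall>b\<in>X k. b \<le> \<Sum>(V k) + L"
    proof
      fix b assume "b \<in> X k"
      then have "real b \<le> real (\<Sum>(V k) + L)" using mem[of k b] bigV[of k] step by force
      then show "b \<le> \<Sum>(V k) + L" by (simp only: of_nat_le_iff)
    qed
    ultimately show ?case using subset_gaps_Un[of "V k" "X k" L] finV fin step by simp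
  qed
  show ?thesis unfolding covers_def
  proof
    fix t
    obtain m where "real t < \<rho> ^ m" using real_arch_pow[OF assms(1)] by blast
    also have "\<rho> ^ m \<le> \<rho> ^ (max k0 m + 1)" using assms(1) by (intro power_increasing) auto
    also have "\<dots> \<le> real (\<Sum>(V (max k0 m)) + L)" by (rule bigV) simp
    finally have "t < \<Sum>(V (max k0 m)) + L" by (simp only: of_nat_less_iff)
    then obtain S where S: "S \<subseteq> V (max k0 m)" "\<Sum>S \<le> t" "t < \<Sum>S + L" using gaps[of "max k0 m"] by auto
    have "finite S" using S(1) finV by (rule finite_subset)
    moreover have "S \<subseteq> (\<Union>k\<in>{k0..}. X k)" using S(1) by (force simp: V_def)
    ultimately have "\<Sum>S \<in> subset_sums (\<Union>k\<in>{k0..}. X k)" by (auto simp: subset_sums_def)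
    with S show "\<exists>s\<in>subset_sums (\<Union>k\<in>{k0..}. X k). s \<le> t \<and> t < s + L" by blast
  qed
qed

section \<open>How many elements per block suffice\<close>

text \<open>
The right-hand side is the least total of two consecutive blocks with \<open>p k\<close> and \<open>p (k + 1)\<close> elements,
the left-hand side is the amount by which the bound \<open>\<rho> ^ (k + 1)\<close> on the elements of block \<open>k\<close> grows
over two steps. Comparing two steps at a time allows for patterns of period two.
\<close>
definition dense_pattern :: "real \<Rightarrow> (nat \<Rightarrow> nat) \<Rightarrow> bool" where
  "dense_pattern \<rho> p \<longleftrightarrow> (\<forall>k. \<rho> ^ (k + 3) - \<rho> ^ (k + 1) \<le> real (p k) * \<rho> ^ k + real (p (k + 1)) * \<rho> ^ (k + 1))"

lemma dense_pattern_sum: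
  assumes "\<rho> > 1" "dense_pattern \<rho> p" "k \<ge> k0" "\<rho> ^ (k0 + 2) \<le> L"
  shows "\<rho> ^ (k + 1) \<le> (\<Sum>j=k0..<k. real (p j) * \<rho> ^ j) + L"
proof -
  have "\<rho> ^ (k0 + m + 1) \<le> (\<Sum>j=k0..<k0 + m. real (p j) * \<rho> ^ j) + L" for m
  proof (induction m rule: induct_nat_012)
    case 0
    have "\<rho> ^ (k0 + 1) \<le> \<rho> ^ (k0 + 2)" using assms(1) by (intro power_increasing) auto
    then show ?case using assms(4) by simp
  next
    case 1
    have "0 \<le> real (p k0) * \<rho> ^ k0" using assms(1) by simp
    then show ?case using assms(4) by (simp add: numeral_2_eq_2)
  next
    case (ge2 m)
    have "\<rho> ^ (k0 + m + 3) - \<rho> ^ (k0 + m + 1) \<le> real (p (k0 + m)) * \<rho> ^ (k0 + m) + real (p (k0 + m + 1)) * \<rho> ^ (k0 + m + 1)"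
      using assms(2) unfolding dense_pattern_def by blast
    then show ?case using ge2(1) by (simp add: numeral_3_eq_3)
  qed
  from this[of "k - k0"] show ?thesis using assms(3) by simp
qed

text \<open>
If the minimum is \<open>2 * u + 1\<close>, both sets take \<open>u\<close> elements of each block. If it is \<open>2 * v\<close>, they
take \<open>v\<close> and \<open>v - 1\<close> elements with the roles exchanged from block to block: from
\<open>v * (\<rho> + 1) \<ge> \<rho> ^ 3\<close> two blocks with \<open>v\<close> elements each have total at least \<open>\<rho> ^ (k + 3)\<close>, and the element that
is left out costs at most \<open>\<rho> ^ (k + 1)\<close>.
\<close>
lemma dense_pattern_exists:
  assumes "\<rho> > 1"
  shows "\<exists>p q. dense_pattern \<rho> p \<and> dense_pattern \<rho> q \<and> (\<forall>k. int (p k + q k) + 1 = M_const \<rho>)"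
proof -
  have u: "\<rho> * (\<rho> - 1) \<le> of_int (u_const \<rho>)" by (simp add: u_const_def)
  have v: "\<rho> ^ 3 / (\<rho> + 1) \<le> of_int (v_const \<rho>)" by (simp only: v_const_def le_of_int_ceiling)
  have "0 < \<rho> * (\<rho> - 1)" "0 < \<rho> ^ 3 / (\<rho> + 1)" using assms by auto
  then have uv0: "0 < u_const \<rho>" "0 < v_const \<rho>" using u v by linarith+
  show ?thesis
  proof (cases "2 * u_const \<rho> + 1 \<le> 2 * v_const \<rho>")
    case True
    define p where "p = (\<lambda>k::nat. nat (u_const \<rho>))"
    have "dense_pattern \<rho> p" unfolding dense_pattern_def
    proof
      fix k
      have "\<rho> ^ (k + 3) - \<rho> ^ (k + 1) = (\<rho> * (\<rho> - 1)) * (\<rho> ^ k + \<rho> ^ (k + 1))"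
        by (simp add: power3_eq_cube power_add algebra_simps)
      also have "\<dots> \<le> of_int (u_const \<rho>) * (\<rho> ^ k + \<rho> ^ (k + 1))"
        using u assms by (intro mult_right_mono) auto
      also have "\<dots> = real (p k) * \<rho> ^ k + real (p (k + 1)) * \<rho> ^ (k + 1)"
        using uv0 by (simp add: p_def ring_distribs)
      finally show "\<rho> ^ (k + 3) - \<rho> ^ (k + 1) \<le> real (p k) * \<rho> ^ k + real (p (k + 1)) * \<rho> ^ (k + 1)" .
    qed
    moreover have "int (p k + p k) + 1 = M_const \<rho>" for k
      using True uv0 by (simp add: p_def M_const_def)
    ultimately show ?thesis by blast
  next
    case False
    define p where "p b = (\<lambda>k::nat. nat (v_const \<rho>) - (if even k = b then 1 else 0))" for b
    have "dense_pattern \<rho> (p b)" for b unfolding dense_pattern_def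
    proof
      fix k
      have p: "real (p b k) = of_int (v_const \<rho>) - (if even k = b then 1 else 0)" for k
        using uv0 by (auto simp: p_def of_nat_diff)
      have "\<rho> ^ (k + 3) = \<rho> ^ 3 / (\<rho> + 1) * (\<rho> ^ k + \<rho> ^ (k + 1))"
      proof -
        have "\<rho> ^ 3 / (\<rho> + 1) * (\<rho> ^ k + \<rho> ^ (k + 1)) = \<rho> ^ 3 / (\<rho> + 1) * ((\<rho> + 1) * \<rho> ^ k)"
          by (simp add: algebra_simps)
        then show ?thesis using assms by (simp add: power_add)
      qed
      also have "\<dots> \<le> of_int (v_const \<rho>) * (\<rho> ^ k + \<rho> ^ (k + 1))"
        using v assms by (intro mult_right_mono) auto
      finally have "\<rho> ^ (k + 3) \<le> of_int (v_const \<rho>) * \<rho> ^ k + of_int (v_const \<rho>) * \<rho> ^ (k + 1)"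
        by (simp add: ring_distribs)
      moreover have "\<rho> ^ k \<le> \<rho> ^ (k + 1)" using assms by (intro power_increasing) auto
      ultimately show "\<rho> ^ (k + 3) - \<rho> ^ (k + 1) \<le> real (p b k) * \<rho> ^ k + real (p b (k + 1)) * \<rho> ^ (k + 1)"
        unfolding p by (cases "even k = b") (auto simp: left_diff_distrib)
    qed
    moreover have "int (p True k + p False k) + 1 = M_const \<rho>" for k
      using False uv0 by (auto simp: p_def M_const_def)
    ultimately show ?thesis by blast
  qed
qed

section \<open>Subset sums far from the integers\<close>

lemma abs_cos_pi_le:
  assumes "0 \<le> \<epsilon>" "\<epsilon> \<le> int_dist x"
  shows "\<bar>cos (pi * x)\<bar> \<le> cos (pi * \<epsilon>)"
proof -
  obtain m :: int where m: "int_dist x = \<bar>x - of_int m\<bar>" by (rule int_dist_attained)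
  define d where "d = x - of_int m"
  have x: "pi * x = pi * d + of_int m * pi" by (simp add: d_def algebra_simps)
  have d: "0 \<le> pi * \<bar>d\<bar>" "pi * \<bar>d\<bar> \<le> pi / 2"
    using int_dist_le_half[of x] m by (auto simp: d_def)
  have "\<bar>cos (pi * x)\<bar> = \<bar>cos (pi * d)\<bar>" unfolding x
    by (simp add: cos_add abs_mult mult.commute[of "of_int m" pi])
  also have "\<bar>cos (pi * d)\<bar> = \<bar>cos (pi * \<bar>d\<bar>)\<bar>" by (cases "d \<ge> 0") auto
  also have "\<dots> = cos (pi * \<bar>d\<bar>)"
    using d pi_gt_zero by (intro abs_of_nonneg cos_ge_zero) linarith+
  also have "\<dots> \<le> cos (pi * \<epsilon>)"
    using assms d m pi_gt_zero by (intro cos_monotone_0_pi_le) (auto simp: d_def)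
  finally show ?thesis .
qed

lemma subset_sum_between:
  fixes f :: "'a \<Rightarrow> real"
  assumes "finite S0" "\<delta> \<le> sum f S0" "\<And>a. a \<in> S0 \<Longrightarrow> f a < \<delta>" "0 < \<delta>"
  shows "\<exists>S\<subseteq>S0. \<delta> \<le> sum f S \<and> sum f S < 2 * \<delta>"
  using assms
proof (induction S0 rule: finite_induct)
  case (insert x F)
  show ?case
  proof (cases "\<delta> \<le> sum f F")
    case True
    then show ?thesis using insert by blast
  next
    case False
    then have "sum f (insert x F) < 2 * \<delta>" using insert by force
    with insert show ?thesis by blast
  qed
qed auto

lemma summable_on_finite_UN:
  fixes f :: "'a \<Rightarrow> real"
  assumes "finite I" "\<And>i. i \<in> I \<Longrightarrow> f summable_on (T i)"
  shows "f summable_on (\<Union>i\<in>I. T i)"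
  using assms by (induction I rule: finite_induct) (auto intro: summable_on_union)

text \<open>
If no single element of \<open>T\<close> works, then all the signed distances are smaller than \<open>\<delta>\<close>, and those
of one sign have a divergent sum. Adding up such elements until the total first reaches
\<open>\<delta>\<close> gives a total in \<open>[\<delta>, 2 * \<delta>)\<close>, which is still at most \<open>1/2\<close>, so that no integer is nearer than \<open>\<delta>\<close>.
\<close>
lemma subset_sum_far_from_integers:
  assumes div: "\<not> (\<lambda>a. int_dist (real a * \<theta>)) summable_on T" and \<delta>: "0 < \<delta>" "\<delta> \<le> 1/4"
  shows "\<exists>S. finite S \<and> S \<subseteq> T \<and> \<delta> \<le> int_dist (real (\<Sum>S) * \<theta>)"
proof (cases "\<exists>a\<in>T. \<delta> \<le> int_dist (real a * \<theta>)")
  case True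
  then obtain a where "a \<in> T" "\<delta> \<le> int_dist (real a * \<theta>)" by blast
  then show ?thesis by (intro exI[of _ "{a}"]) auto
next
  case False
  define f where "f a = int_dist (real a * \<theta>)" for a :: nat
  have "\<exists>m::int. f a = \<bar>real a * \<theta> - of_int m\<bar>" for a unfolding f_def by (metis int_dist_attained)
  then obtain m :: "nat \<Rightarrow> int" where m: "\<And>a. f a = \<bar>real a * \<theta> - of_int (m a)\<bar>" by metis
  define P where "P \<sigma> = {a\<in>T. real a * \<theta> - of_int (m a) = \<sigma> * f a}" for \<sigma>
  have "T \<subseteq> P 1 \<union> P (-1)" using m by (auto simp: P_def abs_if split: if_splits)
  then have "\<not> f summable_on P 1 \<or> \<not> f summable_on P (-1)"
    using div summable_on_union summable_on_subset unfolding f_def by blast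
  then obtain \<sigma> where \<sigma>: "\<sigma> = 1 \<or> \<sigma> = -1" "\<not> f summable_on P \<sigma>" by blast
  have "\<exists>S0. finite S0 \<and> S0 \<subseteq> P \<sigma> \<and> \<delta> \<le> sum f S0"
  proof (rule ccontr)
    assume "\<not> ?thesis"
    then have "\<And>S0. finite S0 \<Longrightarrow> S0 \<subseteq> P \<sigma> \<Longrightarrow> sum f S0 \<le> \<delta>" by (meson linear)
    then have "f summable_on P \<sigma>"
      by (intro nonneg_bounded_partial_sums_imp_summable_on[where C = \<delta>] eventually_finite_subsets_at_top_weakI)
         (auto simp: f_def int_dist_nonneg)
    with \<sigma> show False by simp
  qed
  then obtain S0 where S0: "finite S0" "S0 \<subseteq> P \<sigma>" "\<delta> \<le> sum f S0" by blast
  have "f a < \<delta>" if "a \<in> S0" for a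
    using that S0(2) False by (auto simp: f_def P_def not_le)
  then obtain S where S: "S \<subseteq> S0" "\<delta> \<le> sum f S" "sum f S < 2 * \<delta>"
    using subset_sum_between[OF S0(1,3)] \<delta>(1) by blast
  have "real (\<Sum>S) * \<theta> = (\<Sum>a\<in>S. of_int (m a) + \<sigma> * f a)"
    unfolding of_nat_sum sum_distrib_right using S S0 by (intro sum.cong) (auto simp: P_def algebra_simps)
  then have eq: "real (\<Sum>S) * \<theta> = of_int (\<Sum>a\<in>S. m a) + \<sigma> * sum f S"
    by (simp only: sum.distrib sum_distrib_left of_int_sum)
  have "\<delta> \<le> \<bar>real (\<Sum>S) * \<theta> - of_int i\<bar>" for i :: int
  proof -
    define j where "j = (\<Sum>a\<in>S. m a) - i"
    have "real (\<Sum>S) * \<theta> - of_int i = of_int j + \<sigma> * sum f S" unfolding eq j_def by simp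
    moreover have "j = 0 \<or> real_of_int j \<ge> 1 \<or> real_of_int j \<le> -1" by linarith
    ultimately show ?thesis using S \<delta> \<sigma>(1) by auto
  qed
  then have "\<delta> \<le> int_dist (real (\<Sum>S) * \<theta>)" by (rule int_dist_geI)
  moreover have "finite S" "S \<subseteq> T" using S S0 finite_subset by (auto simp: P_def)
  ultimately show ?thesis by blast
qed

section \<open>Blocks and colourings\<close>

definition block :: "real \<Rightarrow> nat set \<Rightarrow> nat \<Rightarrow> nat set" where
  "block \<rho> A k = {a\<in>A. \<rho> ^ k < real a \<and> real a \<le> \<rho> ^ (k + 1)}"

lemma finite_block: "finite (block \<rho> A k)"
proof (rule finite_subset)
  show "block \<rho> A k \<subseteq> {..nat \<lfloor>\<rho> ^ (k + 1)\<rfloor>}" by (auto simp: block_def) linarith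
qed simp

lemma block_index_unique:
  assumes "\<rho> > 1" "a \<in> block \<rho> A i" "a \<in> block \<rho> B j"
  shows "i = j"
proof -
  have "i \<le> j" if "\<rho> ^ i < \<rho> ^ (j + 1)" for i j
    using power_less_imp_less_exp[OF assms(1) that] by simp
  moreover have "\<rho> ^ i < \<rho> ^ (j + 1)" "\<rho> ^ j < \<rho> ^ (i + 1)" using assms by (auto simp: block_def)
  ultimately show ?thesis by (meson le_antisym)
qed

lemma in_some_block:
  assumes "\<rho> > 1" "a \<in> A" "\<rho> ^ K < real a"
  obtains k where "k \<ge> K" "a \<in> block \<rho> A k"
proof -
  define j where "j = (LEAST j. real a \<le> \<rho> ^ j)"
  obtain j0 where "real a < \<rho> ^ j0" using real_arch_pow[OF assms(1)] by blast
  then have j: "real a \<le> \<rho> ^ j" unfolding j_def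
    using LeastI[of "\<lambda>j. real a \<le> \<rho> ^ j" j0] by simp
  then have "\<rho> ^ K < \<rho> ^ j" using assms by linarith
  then have Kj: "K < j" using assms(1) power_less_imp_less_exp by blast
  then have "\<not> real a \<le> \<rho> ^ (j - 1)" unfolding j_def
    using not_less_Least[of "j - 1" "\<lambda>j. real a \<le> \<rho> ^ j"] by (simp add: j_def)
  then show thesis using that[of "j - 1"] j Kj assms by (auto simp: block_def)
qed

lemma parity_split:
  fixes k s l t :: nat
  assumes "2 * k + s = 2 * l + t" "s < 2" "t < 2"
  shows "k = l \<and> s = t"
  using assms by presburger

text \<open>
A set with this property misses all colours but one in each block. If each block contains all
of the \<open>m\<close> colours, the set therefore leaves at least \<open>m - 1\<close> elements in each block, however large the
blocks are. On the other hand, as there are finitely many colours, the divergent sum over \<open>A\<close> stays divergent on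
one of the colour classes.
\<close>
definition block_monochromatic :: "real \<Rightarrow> nat set \<Rightarrow> (nat \<Rightarrow> nat) \<Rightarrow> nat set \<Rightarrow> bool" where
  "block_monochromatic \<rho> A col F \<longleftrightarrow>
     (\<forall>k. \<forall>a\<in>F \<inter> block \<rho> A k. \<forall>b\<in>F \<inter> block \<rho> A k. col a = col b)"

section \<open>One sparse family for all frequencies\<close>

text \<open>
The argument works with levels: level \<open>k\<close> consists of the two blocks \<open>2 * k\<close> and \<open>2 * k + 1\<close>,
called its sides \<open>0\<close> and \<open>1\<close>. Levels from \<open>K0\<close> on are available.
\<close>
locale coloured_blocks =
  fixes \<rho> :: real and A :: "nat set" and col :: "nat \<Rightarrow> nat" and m K0 :: nat
  assumes rho: "\<rho> > 1"
    and col_less: "\<And>a. a \<in> A \<Longrightarrow> col a < m"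
    and block_nonempty: "\<And>k. k \<ge> 2 * K0 \<Longrightarrow> block \<rho> A k \<noteq> {}"
    and divergent: "\<And>\<theta>. \<theta> \<notin> \<int> \<Longrightarrow> \<not> (\<lambda>a. int_dist (real a * \<theta>)) summable_on A"
begin

definition half_class :: "nat \<Rightarrow> nat \<Rightarrow> nat \<Rightarrow> nat set" where
  "half_class s c K = (\<Union>k\<in>{K..}. {a \<in> block \<rho> A (2 * k + s). col a = c})"

text \<open>
The units that are to be used, all of them located in the levels from \<open>K\<close> up to, and not including,
\<open>K'\<close>. Families in disjoint ranges of levels can be united, which makes this the right notion for step-by-step
constructions.
\<close>
definition unit_family :: "nat \<Rightarrow> nat \<Rightarrow> nat set set \<Rightarrow> bool" where
  "unit_family K K' \<S> \<longleftrightarrow> finite \<S> \<and> {} \<notin> \<S> \<and> (\<forall>S\<in>\<S>. \<forall>T\<in>\<S>. S \<noteq> T \<longrightarrow> S \<inter> T = {}) \<and>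
     (\<forall>S\<in>\<S>. finite S \<and> S \<subseteq> A \<and> (\<forall>a\<in>S. \<rho> ^ (2 * K) < real a \<and> real a \<le> \<rho> ^ (2 * K'))) \<and>
     block_monochromatic \<rho> A col (\<Union>\<S>)"

text \<open>
The value is small enough for \<open>track_width_shrinks\<close>, where \<open>2 * eps * (1 + \<rho> ^ 4) < 1\<close> is needed, and for
an application of \<open>subset_sum_far_from_integers\<close> to \<open>2 * eps\<close>.
\<close>
definition eps :: real where "eps = 1 / (8 * (1 + \<rho> ^ 4))"

text \<open>
The diameter to which a set of frequencies is confined once \<open>real c * \<theta>\<close> is known to be within \<open>eps\<close>
of one fixed integer for some \<open>c\<close> in level \<open>K - 1\<close>; see \<open>track_width_Suc\<close>.
\<close>
definition track_width :: "nat \<Rightarrow> real" where "track_width K = 2 * eps * \<rho> ^ 2 / \<rho> ^ (2 * K)"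

lemma rho_power_mono: "i \<le> j \<Longrightarrow> \<rho> ^ i \<le> \<rho> ^ j"
  using rho by (intro power_increasing) auto

lemma rho_power_pos: "0 < \<rho> ^ i"
  using rho by simp

lemma eps_eq: "eps * (1 + \<rho> ^ 4) = 1 / 8"
proof -
  have "1 + \<rho> ^ 4 \<noteq> 0" using rho_power_pos[of 4] by linarith
  then show ?thesis by (simp add: eps_def)
qed

lemma eps_pos: "0 < eps"
proof -
  have "0 < 8 * (1 + \<rho> ^ 4)" using rho_power_pos[of 4] by (intro mult_pos_pos) linarith+
  then show ?thesis unfolding eps_def by (intro divide_pos_pos) simp_all
qed

lemma eps_less: "2 * eps + 2 * eps * \<rho> ^ 4 < 1" "2 * eps \<le> 1/4"
proof -
  have "eps + eps * \<rho> ^ 4 = 1 / 8" using eps_eq by (simp add: distrib_left)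
  moreover have "0 < eps * \<rho> ^ 4" using eps_pos rho_power_pos by (intro mult_pos_pos)
  ultimately show "2 * eps + 2 * eps * \<rho> ^ 4 < 1" "2 * eps \<le> 1/4" by linarith+
qed

lemma track_width_Suc: "track_width (Suc K) = 2 * eps / \<rho> ^ (2 * K)"
  using rho by (simp add: track_width_def power_add power2_eq_square)

lemma track_width_pos: "0 < track_width K"
  using eps_pos rho by (simp add: track_width_def)

lemma half_class_divergent:
  assumes "\<theta> \<notin> \<int>"
  shows "\<exists>s<2. \<exists>c<m. \<not> (\<lambda>a. int_dist (real a * \<theta>)) summable_on half_class s c K"
proof (rule ccontr)
  define f where "f = (\<lambda>a. int_dist (real a * \<theta>))"
  define I where "I = {..<2::nat} \<times> {..<m}"
  assume "\<not> ?thesis"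
  then have "f summable_on (\<Union>(s,c)\<in>I. half_class s c K)"
    unfolding f_def by (intro summable_on_finite_UN) (auto simp: I_def)
  moreover have "finite {a. real a \<le> \<rho> ^ (2 * K)}"
    by (rule finite_subset[of _ "{..nat \<lfloor>\<rho> ^ (2 * K)\<rfloor>}"]) (auto, linarith)
  ultimately have "f summable_on ({a. real a \<le> \<rho> ^ (2 * K)} \<union> (\<Union>(s,c)\<in>I. half_class s c K))"
    by (intro summable_on_union) auto
  moreover have "A \<subseteq> {a. real a \<le> \<rho> ^ (2 * K)} \<union> (\<Union>(s,c)\<in>I. half_class s c K)"
  proof
    fix a assume a: "a \<in> A"
    show "a \<in> {a. real a \<le> \<rho> ^ (2 * K)} \<union> (\<Union>(s,c)\<in>I. half_class s c K)"
    proof (cases "real a \<le> \<rho> ^ (2 * K)")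
      case False
      then obtain k where k: "k \<ge> 2 * K" "a \<in> block \<rho> A k"
        using in_some_block[OF rho a, of "2 * K"] by auto
      then have "a \<in> half_class (k mod 2) (col a) K"
        unfolding half_class_def by (intro UN_I[of "k div 2"]) auto
      moreover have "(k mod 2, col a) \<in> I" using col_less[OF a] by (simp add: I_def)
      ultimately show ?thesis by blast
    qed simp
  qed
  ultimately have "f summable_on A" by (rule summable_on_subset)
  with divergent[OF assms] show False by (simp add: f_def)
qed

text \<open>
The range \<open>{K..<K1}\<close> of the first family and the range \<open>{K1..<K2}\<close> of the second have no block in common,
so colours need not be compared between the two families.
\<close>
lemma unit_family_Un:
  assumes "unit_family K K1 \<S>" "unit_family K1 K2 \<T>" "K \<le> K1" "K1 \<le> K2"
  shows "unit_family K K2 (\<S> \<union> \<T>)" "\<S> \<inter> \<T> = {}"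
proof -
  have S: "finite S \<and> S \<subseteq> A \<and> (\<forall>a\<in>S. \<rho> ^ (2 * K) < real a \<and> real a \<le> \<rho> ^ (2 * K1))" if "S \<in> \<S>" for S
    using assms(1) that by (auto simp: unit_family_def)
  have T: "finite S \<and> S \<subseteq> A \<and> (\<forall>a\<in>S. \<rho> ^ (2 * K1) < real a \<and> real a \<le> \<rho> ^ (2 * K2))" if "S \<in> \<T>" for S
    using assms(2) that by (auto simp: unit_family_def)
  have disj: "S \<inter> T = {}" if "S \<in> \<S>" "T \<in> \<T>" for S T
    using S[OF that(1)] T[OF that(2)] by force
  have ne: "{} \<notin> \<S>" "{} \<notin> \<T>" using assms by (auto simp: unit_family_def)
  show "\<S> \<inter> \<T> = {}" using disj ne by (metis Int_iff ex_in_conv inf.idem)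
  have "block_monochromatic \<rho> A col (\<Union>(\<S> \<union> \<T>))" unfolding block_monochromatic_def
  proof (intro allI ballI)
    fix k a b assume ab: "a \<in> \<Union>(\<S> \<union> \<T>) \<inter> block \<rho> A k" "b \<in> \<Union>(\<S> \<union> \<T>) \<inter> block \<rho> A k"
    have no: False if "x \<in> \<Union>\<S>" "y \<in> \<Union>\<T>" "x \<in> block \<rho> A k" "y \<in> block \<rho> A k" for x y
    proof -
      have "real x \<le> \<rho> ^ (2 * K1)" "\<rho> ^ (2 * K1) < real y" using S T that by auto
      moreover have "\<rho> ^ k < real x" "real y \<le> \<rho> ^ (k + 1)" using that by (auto simp: block_def)
      ultimately have "\<rho> ^ k < \<rho> ^ (2 * K1)" "\<rho> ^ (2 * K1) < \<rho> ^ (k + 1)" by linarith+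
      then have "k < 2 * K1" "2 * K1 < k + 1" using power_less_imp_less_exp[OF rho] by blast+
      then show False by simp
    qed
    have "(a \<in> \<Union>\<S> \<and> b \<in> \<Union>\<S>) \<or> (a \<in> \<Union>\<T> \<and> b \<in> \<Union>\<T>)" using ab no by blast
    then show "col a = col b"
    proof
      assume "a \<in> \<Union>\<S> \<and> b \<in> \<Union>\<S>"
      then have "a \<in> \<Union>\<S> \<inter> block \<rho> A k" "b \<in> \<Union>\<S> \<inter> block \<rho> A k" using ab by auto
      moreover have "block_monochromatic \<rho> A col (\<Union>\<S>)" using assms(1) by (simp add: unit_family_def)
      ultimately show ?thesis unfolding block_monochromatic_def by metis
    next
      assume "a \<in> \<Union>\<T> \<and> b \<in> \<Union>\<T>"
      then have "a \<in> \<Union>\<T> \<inter> block \<rho> A k" "b \<in> \<Union>\<T> \<inter> block \<rho> A k" using ab by auto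
      moreover have "block_monochromatic \<rho> A col (\<Union>\<T>)" using assms(2) by (simp add: unit_family_def)
      ultimately show ?thesis unfolding block_monochromatic_def by metis
    qed
  qed
  moreover have "S \<inter> T = {}" if "S \<in> \<S> \<union> \<T>" "T \<in> \<S> \<union> \<T>" "S \<noteq> T" for S T
  proof -
    have "S \<in> \<S> \<Longrightarrow> T \<in> \<S> \<Longrightarrow> S \<inter> T = {}" "S \<in> \<T> \<Longrightarrow> T \<in> \<T> \<Longrightarrow> S \<inter> T = {}"
      using assms(1,2) that(3) by (simp_all add: unit_family_def)
    then show ?thesis using that(1,2) disj[of S T] disj[of T S] by (auto simp only: Un_iff Int_commute)
  qed
  moreover have "finite S \<and> S \<subseteq> A \<and> (\<forall>a\<in>S. \<rho> ^ (2 * K) < real a \<and> real a \<le> \<rho> ^ (2 * K2))" if "S \<in> \<S> \<union> \<T>" for S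
  proof -
    have "\<rho> ^ (2 * K) \<le> \<rho> ^ (2 * K1)" "\<rho> ^ (2 * K1) \<le> \<rho> ^ (2 * K2)"
      using assms(3,4) by (auto intro: rho_power_mono)
    then show ?thesis using that S[of S] T[of S] by force
  qed
  moreover have "finite (\<S> \<union> \<T>)" using assms(1,2) by (simp add: unit_family_def)
  ultimately show "unit_family K K2 (\<S> \<union> \<T>)"
    unfolding unit_family_def using ne by simp
qed

text \<open>
On a set of diameter \<open>track_width K\<close> the value of \<open>real c * x\<close> varies by less than \<open>1 - 2 * eps\<close>. Two points at
which it is within \<open>eps\<close> of an integer therefore share this integer, so their images are within \<open>2 * eps\<close>. Here the bounded
ratio of consecutive \<open>c\<close> is essential; it is the reason for taking one element in each level.
\<close>
lemma track_width_shrinks: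
  assumes c: "\<rho> ^ (2 * K) < real c" "real c \<le> \<rho> ^ (2 * K + 2)"
    and xy: "\<bar>x - y\<bar> \<le> track_width K" "int_dist (real c * x) \<le> eps" "int_dist (real c * y) \<le> eps"
  shows "\<bar>x - y\<bar> \<le> track_width (Suc K)"
proof -
  obtain p :: int where p: "\<bar>real c * x - of_int p\<bar> \<le> eps" using xy(2) by (metis int_dist_attained)
  obtain q :: int where q: "\<bar>real c * y - of_int q\<bar> \<le> eps" using xy(3) by (metis int_dist_attained)
  have "\<bar>real c * x - real c * y\<bar> = real c * \<bar>x - y\<bar>"
    by (simp add: abs_mult flip: right_diff_distrib)
  also have "\<dots> \<le> \<rho> ^ (2 * K + 2) * track_width K"
    using c xy(1) rho_power_pos by (intro mult_mono) auto
  also have "\<dots> = 2 * eps * \<rho> ^ 4"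
    using rho by (simp add: track_width_def power_add power2_eq_square power4_eq_xxxx)
  finally have "\<bar>real c * x - real c * y\<bar> \<le> 2 * eps * \<rho> ^ 4" .
  then have "\<bar>real_of_int p - of_int q\<bar> < 1" using p q eps_less by linarith
  then have "p = q" by linarith
  then have "\<bar>real c * x - real c * y\<bar> \<le> 2 * eps" using p q by linarith
  then have *: "real c * \<bar>x - y\<bar> \<le> 2 * eps" by (simp add: abs_mult flip: right_diff_distrib)
  have "\<rho> ^ (2 * K) * \<bar>x - y\<bar> \<le> real c * \<bar>x - y\<bar>" using c by (intro mult_right_mono) auto
  with * have "\<rho> ^ (2 * K) * \<bar>x - y\<bar> \<le> 2 * eps" by linarith
  then show ?thesis unfolding track_width_Suc using rho_power_pos[of "2 * K"] by (simp add: field_simps)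
qed

lemma survivors_close:
  assumes c: "\<And>i. K \<le> i \<Longrightarrow> i < k \<Longrightarrow> \<rho> ^ (2 * i) < real (c i) \<and> real (c i) \<le> \<rho> ^ (2 * i + 2)"
    and "K \<le> k" "\<bar>x - y\<bar> \<le> track_width K"
    and "\<And>i. K \<le> i \<Longrightarrow> i < k \<Longrightarrow> int_dist (real (c i) * x) \<le> eps"
    and "\<And>i. K \<le> i \<Longrightarrow> i < k \<Longrightarrow> int_dist (real (c i) * y) \<le> eps"
  shows "\<bar>x - y\<bar> \<le> track_width k"
  using assms(2) assms(1,3-)
proof (induction k rule: dec_induct)
  case (step k)
  then show ?case by (intro track_width_shrinks[of k "c k"]) auto
qed

lemma half_block_bounds:
  assumes "a \<in> block \<rho> A (2 * k + s)" "s < 2"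
  shows "\<rho> ^ (2 * k) < real a" "real a \<le> \<rho> ^ (2 * k + 2)"
proof -
  have "\<rho> ^ (2 * k) \<le> \<rho> ^ (2 * k + s)" "\<rho> ^ (2 * k + s + 1) \<le> \<rho> ^ (2 * k + 2)"
    using assms(2) by (intro rho_power_mono; simp)+
  then show "\<rho> ^ (2 * k) < real a" "real a \<le> \<rho> ^ (2 * k + 2)"
    using assms(1) unfolding block_def mem_Collect_eq by linarith+
qed

lemma half_block_unique:
  assumes "a \<in> block \<rho> A (2 * k + s)" "a \<in> block \<rho> A (2 * l + t)" "s < 2" "t < 2"
  shows "k = l \<and> s = t"
proof -
  have "2 * k + s = 2 * l + t" using block_index_unique[OF rho] assms by blast
  then show ?thesis using assms(3,4) by (rule parity_split)
qed

text \<open>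
The track \<open>c\<close> and the unit \<open>S\<close> lie on opposite sides of the levels that both of them visit, so each
block contains at most one element of the track or only elements of \<open>S\<close>, which have the
common colour \<open>j\<close>. Removing the empty set covers the case in which no unit \<open>S\<close> is wanted.
\<close>
lemma unit_family_tracks:
  assumes c: "\<And>k. K \<le> k \<Longrightarrow> k < K' \<Longrightarrow> side k < 2 \<and> c k \<in> block \<rho> A (2 * k + side k)"
    and S: "finite S" "S \<subseteq> half_class s j K1" "s < 2" "\<And>a. a \<in> S \<Longrightarrow> real a \<le> \<rho> ^ (2 * K')"
    and K: "K \<le> K1" "\<And>k. K1 \<le> k \<Longrightarrow> side k \<noteq> s"
  shows "unit_family K K' ((\<lambda>k. {c k}) ` {K..<K'} \<union> ({S} - {{}}))"
proof -
  let ?\<S> = "(\<lambda>k. {c k}) ` {K..<K'} \<union> ({S} - {{}})"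
  have inS: "\<exists>k\<ge>K1. a \<in> block \<rho> A (2 * k + s) \<and> col a = j" if "a \<in> S" for a
    using S(2) that by (auto simp: half_class_def)
  have cS: "c k \<notin> S" if "K \<le> k" "k < K'" for k
  proof
    assume "c k \<in> S"
    then obtain l where "l \<ge> K1" "c k \<in> block \<rho> A (2 * l + s)" using inS by blast
    with half_block_unique[of "c k" k "side k" l s] c[OF that] S(3) K(2) show False by auto
  qed
  have mono: "block_monochromatic \<rho> A col (\<Union>?\<S>)" unfolding block_monochromatic_def
  proof (intro allI ballI)
    fix i a b assume ab: "a \<in> \<Union>?\<S> \<inter> block \<rho> A i" "b \<in> \<Union>?\<S> \<inter> block \<rho> A i"
    have mixed: False
      if x: "x \<in> S" "x \<in> block \<rho> A i" and k: "c k \<in> block \<rho> A i" "K \<le> k" "k < K'" for x k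
    proof -
      obtain l where l: "l \<ge> K1" "x \<in> block \<rho> A (2 * l + s)" using inS[OF x(1)] by blast
      have "2 * l + s = i" by (rule block_index_unique[OF rho l(2) x(2)])
      moreover have "2 * k + side k = i"
        using block_index_unique[OF rho _ k(1)] c k by blast
      ultimately have "2 * l + s = 2 * k + side k" by simp
      then have "l = k \<and> s = side k" using parity_split[of l s k "side k"] S(3) c[OF k(2,3)] by blast
      then show False using K(2) l by auto
    qed
    have tracks: "k = l" if "c k \<in> block \<rho> A i" "c l \<in> block \<rho> A i" "K \<le> k" "k < K'" "K \<le> l" "l < K'" for k l
    proof -
      have "2 * k + side k = i" "2 * l + side l = i"
        using block_index_unique[OF rho _ that(1)] block_index_unique[OF rho _ that(2)] c that by blast+
      then have "2 * k + side k = 2 * l + side l" by simp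
      then show ?thesis using parity_split[of k "side k" l "side l"] c that by blast
    qed
    have "a \<in> S \<or> (\<exists>k. K \<le> k \<and> k < K' \<and> a = c k)" "b \<in> S \<or> (\<exists>k. K \<le> k \<and> k < K' \<and> b = c k)"
      using ab by (auto split: if_splits)
    then show "col a = col b" using ab mixed tracks inS by (metis IntD2)
  qed
  have bnd: "\<rho> ^ (2 * K) < real a \<and> real a \<le> \<rho> ^ (2 * K') \<and> a \<in> A" if a: "a \<in> \<Union>?\<S>" for a
  proof (cases "a \<in> S")
    case True
    then obtain k where k: "k \<ge> K1" "a \<in> block \<rho> A (2 * k + s)" using inS by blast
    then have "\<rho> ^ (2 * k) < real a" "\<rho> ^ (2 * K) \<le> \<rho> ^ (2 * k)"
      using half_block_bounds S(3) K(1) by (auto intro: rho_power_mono)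
    then show ?thesis using S(4)[OF True] k by (auto simp: block_def)
  next
    case False
    then obtain k where k: "K \<le> k" "k < K'" "a = c k" using a by (auto split: if_splits)
    then have "a \<in> block \<rho> A (2 * k + side k)" "side k < 2" using c by auto
    then have "\<rho> ^ (2 * k) < real a" "real a \<le> \<rho> ^ (2 * k + 2)" "a \<in> A"
      using half_block_bounds by (auto simp: block_def)
    moreover have "\<rho> ^ (2 * K) \<le> \<rho> ^ (2 * k)" "\<rho> ^ (2 * k + 2) \<le> \<rho> ^ (2 * K')"
      using k by (intro rho_power_mono; simp)+
    ultimately show ?thesis by (meson le_less_trans order_trans)
  qed
  show ?thesis unfolding unit_family_def
  proof (intro conjI ballI)
    fix U assume U: "U \<in> ?\<S>"
    show "finite U" using U S(1) by auto
    show "U \<subseteq> A" using bnd U by blast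
    show "U \<noteq> V \<longrightarrow> U \<inter> V = {}" if "V \<in> ?\<S>" for V using U that cS by auto
    fix a assume "a \<in> U"
    then show "\<rho> ^ (2 * K) < real a" "real a \<le> \<rho> ^ (2 * K')" using bnd U by blast+
  qed (use mono in auto)
qed

definition dist_far :: "real \<Rightarrow> nat set \<Rightarrow> bool" where
  "dist_far \<theta> S \<longleftrightarrow> eps \<le> int_dist (real (\<Sum>S) * \<theta>)"

text \<open>
Besides treating all frequencies in \<open>J\<close>, the family contains an element \<open>c k\<close> of every level as a unit of
its own. This keeps the other sets of candidates small while \<open>J\<close> is being dealt with.
\<close>
definition resolvable :: "nat \<Rightarrow> real set \<Rightarrow> bool" where
  "resolvable K J \<longleftrightarrow> (\<exists>K' c \<S>. K \<le> K' \<and> unit_family K K' \<S> \<and>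
     (\<forall>k. K \<le> k \<and> k < K' \<longrightarrow> {c k} \<in> \<S> \<and> \<rho> ^ (2 * k) < real (c k) \<and> real (c k) \<le> \<rho> ^ (2 * k + 2)) \<and>
     (\<forall>\<theta>\<in>J. \<exists>S\<in>\<S>. dist_far \<theta> S))"

lemma resolvable_if_no_survivor:
  assumes c: "\<And>k. K \<le> k \<Longrightarrow> k < K' \<Longrightarrow> c k \<in> block \<rho> A (2 * k)" and "K \<le> K'"
    and none: "\<And>\<theta>. \<theta> \<in> J \<Longrightarrow> \<exists>k. K \<le> k \<and> k < K' \<and> eps < int_dist (real (c k) * \<theta>)"
  shows "resolvable K J"
proof -
  let ?\<S> = "(\<lambda>k. {c k}) ` {K..<K'} \<union> ({{}} - {{}})"
  have "unit_family K K' ?\<S>"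
    by (rule unit_family_tracks[where side = "\<lambda>_. 0" and s = 1 and ?K1.0 = K and j = 0]) (use c in auto)
  moreover have "\<forall>\<theta>\<in>J. \<exists>S\<in>?\<S>. dist_far \<theta> S"
  proof
    fix \<theta> assume "\<theta> \<in> J"
    then obtain k where "K \<le> k" "k < K'" "eps < int_dist (real (c k) * \<theta>)" using none by blast
    then show "\<exists>S\<in>?\<S>. dist_far \<theta> S" by (intro bexI[of _ "{c k}"]) (auto simp: dist_far_def)
  qed
  moreover have "\<rho> ^ (2 * k) < real (c k) \<and> real (c k) \<le> \<rho> ^ (2 * k + 2)" if "K \<le> k" "k < K'" for k
    using half_block_bounds[of "c k" k 0] c[OF that] by simp
  ultimately show ?thesis unfolding resolvable_def using \<open>K \<le> K'\<close>
    by (intro exI[of _ K'] exI[of _ c] exI[of _ ?\<S>]) auto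
qed

text \<open>
The candidates that survive the track \<open>c\<close> up to a high level lie very close to the survivor \<open>\<theta>\<close>. So a unit
\<open>S\<close> with \<open>\<Sum>S * \<theta>\<close> at distance at least \<open>2 * eps\<close> from the integers takes care of all of them, once the
track has been continued so far that \<open>\<Sum>S\<close> times the width of the surviving set is at most \<open>eps\<close>.
\<close>
lemma resolvable_if_survivor:
  assumes small: "\<And>x y. x \<in> J \<Longrightarrow> y \<in> J \<Longrightarrow> \<bar>x - y\<bar> \<le> track_width K"
    and \<theta>: "\<theta> \<in> J"
    and c: "\<And>k. K \<le> k \<Longrightarrow> side k < 2 \<and> c k \<in> block \<rho> A (2 * k + side k)"
    and surv: "\<And>k. K \<le> k \<Longrightarrow> int_dist (real (c k) * \<theta>) \<le> eps"
    and K1: "K \<le> K1" "\<And>k. K1 \<le> k \<Longrightarrow> side k \<noteq> s" and s: "s < 2"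
    and div: "\<not> (\<lambda>a. int_dist (real a * \<theta>)) summable_on half_class s j K1"
  shows "resolvable K J"
proof -
  obtain S where S: "finite S" "S \<subseteq> half_class s j K1" "2 * eps \<le> int_dist (real (\<Sum>S) * \<theta>)"
    using subset_sum_far_from_integers[OF div, of "2 * eps"] eps_pos eps_less(2) by auto
  have cb: "\<rho> ^ (2 * k) < real (c k) \<and> real (c k) \<le> \<rho> ^ (2 * k + 2)" if "K \<le> k" for k
    using half_block_bounds[of "c k" k "side k"] c[OF that] by simp
  define \<sigma> where "\<sigma> = real (\<Sum>S)"
  obtain N1 where N1: "\<sigma> * (2 * eps * \<rho> ^ 2) / eps + \<sigma> < \<rho> ^ N1" using real_arch_pow[OF rho] by blast
  define K' where "K' = max K N1"
  have "\<rho> ^ N1 \<le> \<rho> ^ (2 * K')" by (rule rho_power_mono) (simp add: K'_def)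
  then have big: "\<sigma> * (2 * eps * \<rho> ^ 2) / eps + \<sigma> < \<rho> ^ (2 * K')" using N1 by linarith
  have \<sigma>0: "0 \<le> \<sigma>" unfolding \<sigma>_def by (rule of_nat_0_le_iff)
  have "0 \<le> \<sigma> * (2 * eps * \<rho> ^ 2) / eps" using \<sigma>0 eps_pos by simp
  then have b1: "\<sigma> \<le> \<rho> ^ (2 * K')" and b2: "\<sigma> * (2 * eps * \<rho> ^ 2) / eps \<le> \<rho> ^ (2 * K')"
    using big \<sigma>0 by linarith+
  have "\<sigma> * (2 * eps * \<rho> ^ 2) \<le> \<rho> ^ (2 * K') * eps" using b2 eps_pos by (simp only: pos_divide_le_eq)
  then have wid: "\<sigma> * track_width K' \<le> eps"
    unfolding track_width_def using rho_power_pos[of "2 * K'"] by (simp add: field_simps)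
  have "real a \<le> \<rho> ^ (2 * K')" if "a \<in> S" for a
  proof -
    have "a \<le> \<Sum>S" using that S(1) by (intro member_le_sum) auto
    then have "real a \<le> \<sigma>" unfolding \<sigma>_def by (simp only: of_nat_le_iff)
    then show ?thesis using b1 by linarith
  qed
  let ?\<S> = "(\<lambda>k. {c k}) ` {K..<K'} \<union> ({S} - {{}})"
  have "unit_family K K' ?\<S>"
    by (rule unit_family_tracks[OF _ S(1,2) s _ K1]) (use c \<open>\<And>a. a \<in> S \<Longrightarrow> real a \<le> \<rho> ^ (2 * K')\<close> in auto)
  moreover have "\<exists>T\<in>?\<S>. dist_far x T" if x: "x \<in> J" for x
  proof (cases "\<exists>k. K \<le> k \<and> k < K' \<and> eps < int_dist (real (c k) * x)")
    case True
    then obtain k where "K \<le> k" "k < K'" "eps < int_dist (real (c k) * x)" by blast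
    then show ?thesis by (intro bexI[of _ "{c k}"]) (auto simp: dist_far_def)
  next
    case False
    have "\<bar>x - \<theta>\<bar> \<le> track_width K'"
      by (rule survivors_close[of K K' c]) (use cb False surv small[OF x \<theta>] in \<open>auto simp: K'_def not_less\<close>)
    then have "\<sigma> * \<bar>x - \<theta>\<bar> \<le> \<sigma> * track_width K'" using \<sigma>0 by (intro mult_left_mono)
    then have "\<bar>\<sigma> * x - \<sigma> * \<theta>\<bar> \<le> eps"
      using wid \<sigma>0 by (simp add: abs_mult flip: right_diff_distrib)
    then have "eps \<le> int_dist (\<sigma> * x)"
      using int_dist_lipschitz[of "\<sigma> * x" "\<sigma> * \<theta>"] S(3) unfolding \<sigma>_def[symmetric] by linarith
    moreover have "S \<noteq> {}"
    proof
      assume "S = {}"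
      then have "int_dist (real (\<Sum>S) * \<theta>) \<le> 0" using int_dist_le[of 0 0] by simp
      then show False using S(3) eps_pos by linarith
    qed
    ultimately show ?thesis by (intro bexI[of _ S]) (auto simp: dist_far_def \<sigma>_def)
  qed
  ultimately show ?thesis unfolding resolvable_def using cb
    by (intro exI[of _ K'] exI[of _ c] exI[of _ ?\<S>]) (auto simp: K'_def)
qed

text \<open>
First let the track run on side \<open>0\<close> for ever. If no frequency of \<open>J\<close> survives, compactness gives a
finite level at which none is left. Otherwise let \<open>\<theta>\<close> be a survivor. If the elements on side \<open>1\<close> have a
divergent sum at \<open>\<theta>\<close>, the unit is taken there. If not, then \<open>c 1 k * \<theta>\<close> is eventually near the
integers, so \<open>\<theta>\<close> also survives the track that changes over to side \<open>1\<close> at a late level. This frees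
side \<open>0\<close>, where the sum must diverge, for the unit.
\<close>
lemma small_set_resolvable:
  assumes "K0 \<le> K" "compact J" "J \<inter> \<int> = {}"
    and small: "\<And>x y. x \<in> J \<Longrightarrow> y \<in> J \<Longrightarrow> \<bar>x - y\<bar> \<le> track_width K"
  shows "resolvable K J"
proof -
  define c where "c s k = (SOME a. a \<in> block \<rho> A (2 * k + s))" for s k
  have c: "c s k \<in> block \<rho> A (2 * k + s)" if "K \<le> k" for s k
    unfolding c_def by (rule someI_ex) (use block_nonempty[of "2 * k + s"] that assms(1) in auto)
  define J' where "J' n = {\<theta>\<in>J. \<forall>k\<in>{K..<K + n}. int_dist (real (c 0 k) * \<theta>) \<le> eps}" for n
  show ?thesis
  proof (cases "\<exists>n. J' n = {}")
    case True
    then obtain n where "J' n = {}" by blast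
    then have "\<exists>k\<in>{K..<K + n}. eps < int_dist (real (c 0 k) * \<theta>)" if "\<theta> \<in> J" for \<theta>
      using that by (auto simp: J'_def not_le)
    then show ?thesis
      by (intro resolvable_if_no_survivor[of K "K + n" "c 0"]) (use c[of _ 0] in \<open>auto simp: Bex_def\<close>)
  next
    case False
    have "compact (J' n)" for n
    proof -
      have "J' n = J \<inter> (\<Inter>k\<in>{K..<K + n}. {\<theta>. int_dist (real (c 0 k) * \<theta>) \<le> eps})" by (auto simp: J'_def)
      also have "compact \<dots>" using assms(2)
        by (intro compact_Int_closed closed_INT ballI closed_Collect_le continuous_intros)
      finally show ?thesis .
    qed
    then have "\<Inter>(range J') \<noteq> {}"
      using False by (intro compact_nest) (auto simp: J'_def)
    then obtain \<theta> where \<theta>: "\<And>n. \<theta> \<in> J' n" by blast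
    then have \<theta>J: "\<theta> \<in> J" by (auto simp: J'_def)
    have surv: "int_dist (real (c 0 k) * \<theta>) \<le> eps" if "K \<le> k" for k
      using \<theta>[of "Suc k - K"] that by (auto simp: J'_def)
    show ?thesis
    proof (cases "\<exists>j. \<not> (\<lambda>a. int_dist (real a * \<theta>)) summable_on half_class 1 j K")
      case True
      then obtain j where "\<not> (\<lambda>a. int_dist (real a * \<theta>)) summable_on half_class 1 j K" by blast
      then show ?thesis
        by (intro resolvable_if_survivor[where side = "\<lambda>_. 0" and c = "c 0" and s = 1 and ?K1.0 = K and j = j and \<theta> = \<theta>])
           (use small \<theta>J c[of _ 0] surv in auto)
    next
      case odd: False
      have "\<exists>K1\<ge>K. \<forall>k\<ge>K1. int_dist (real (c 1 k) * \<theta>) \<le> eps"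
      proof (rule ccontr)
        assume no: "\<not> ?thesis"
        \<comment> \<open>Infinitely many terms larger than \<open>eps\<close> would contradict summability on side \<open>1\<close>.\<close>
        define I where "I = {k. K \<le> k \<and> eps < int_dist (real (c 1 k) * \<theta>)}"
        have "infinite I" unfolding infinite_nat_iff_unbounded_le
        proof
          fix n show "\<exists>k\<ge>n. k \<in> I" using no[simplified, rule_format, of "max K n"] by (auto simp: I_def not_le)
        qed
        have inj: "inj_on (c 1) I"
        proof (rule inj_onI)
          fix k l assume kl: "k \<in> I" "l \<in> I" "c 1 k = c 1 l"
          then show "k = l" using half_block_unique[of "c 1 k" k 1 l 1] c[of k 1] c[of l 1] by (auto simp: I_def)
        qed
        have "(\<lambda>a. int_dist (real a * \<theta>)) summable_on (\<Union>j\<in>{..<m}. half_class 1 j K)"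
          using odd by (intro summable_on_finite_UN) auto
        moreover have "c 1 ` I \<subseteq> (\<Union>j\<in>{..<m}. half_class 1 j K)"
        proof safe
          fix k assume "k \<in> I"
          then have "K \<le> k" by (simp add: I_def)
          then have "c 1 k \<in> half_class 1 (col (c 1 k)) K" using c[of k 1] by (auto simp: half_class_def)
          moreover have "col (c 1 k) < m" using col_less c[OF \<open>K \<le> k\<close>, of 1] by (auto simp: block_def)
          ultimately show "c 1 k \<in> (\<Union>j\<in>{..<m}. half_class 1 j K)" by blast
        qed
        ultimately have "(\<lambda>a. int_dist (real a * \<theta>)) summable_on (c 1 ` I)" by (rule summable_on_subset)
        then have sumI: "(\<lambda>k. int_dist (real (c 1 k) * \<theta>)) summable_on I"
          by (simp only: summable_on_reindex[OF inj] o_def)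
        obtain n where n: "infsum (\<lambda>k. int_dist (real (c 1 k) * \<theta>)) I < real n * eps"
          using reals_Archimedean3[OF eps_pos] by blast
        obtain X where X: "X \<subseteq> I" "finite X" "card X = n"
          using infinite_arbitrarily_large[OF \<open>infinite I\<close>] by blast
        have "real n * eps = (\<Sum>k\<in>X. eps)" using X by simp
        also have "\<dots> \<le> (\<Sum>k\<in>X. int_dist (real (c 1 k) * \<theta>))"
          using X(1) by (intro sum_mono) (auto simp: I_def)
        also have "\<dots> \<le> infsum (\<lambda>k. int_dist (real (c 1 k) * \<theta>)) I"
          using X sumI by (intro finite_sum_le_infsum) (auto simp: int_dist_nonneg)
        finally show False using n by linarith
      qed
      then obtain K1 where K1: "K \<le> K1" "\<And>k. K1 \<le> k \<Longrightarrow> int_dist (real (c 1 k) * \<theta>) \<le> eps" by blast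
      have "\<theta> \<notin> \<int>" using \<theta>J assms(3) by blast
      then obtain s j where sj: "s < 2" "\<not> (\<lambda>a. int_dist (real a * \<theta>)) summable_on half_class s j K1"
        using half_class_divergent[of \<theta> K1] by blast
      have "half_class 1 j K1 \<subseteq> half_class 1 j K"
        using K1(1) unfolding half_class_def by (intro UN_mono) auto
      then have "(\<lambda>a. int_dist (real a * \<theta>)) summable_on half_class 1 j K1"
        using odd summable_on_subset by blast
      then have "s \<noteq> 1" using sj(2) by auto
      then have "s = 0" using sj(1) by simp
      define side where "side k = (if k < K1 then 0 else 1 :: nat)" for k
      show ?thesis
        by (rule resolvable_if_survivor[where side = side and c = "\<lambda>k. c (side k) k" and s = s and ?K1.0 = K1 and j = j and \<theta> = \<theta>])
           (use small \<theta>J c surv K1 sj \<open>s = 0\<close> in \<open>auto simp: side_def\<close>)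
    qed
  qed
qed

text \<open>
While one set is treated, its track cuts each of the other sets down to the width belonging to the
next free level, so the induction hypothesis applies there with one set less.
\<close>
lemma finitely_many_small_sets_resolvable:
  fixes J :: "nat \<Rightarrow> real set"
  assumes "K0 \<le> K"
    and "\<And>i. i < n \<Longrightarrow> compact (J i) \<and> J i \<inter> \<int> = {} \<and> (\<forall>x\<in>J i. \<forall>y\<in>J i. \<bar>x - y\<bar> \<le> track_width K)"
  shows "\<exists>K' \<S>. K \<le> K' \<and> unit_family K K' \<S> \<and> (\<forall>i<n. \<forall>\<theta>\<in>J i. \<exists>S\<in>\<S>. dist_far \<theta> S)"
  using assms
proof (induction n arbitrary: K J)
  case 0
  have "unit_family K K {}" by (simp add: unit_family_def block_monochromatic_def)
  then show ?case by auto
next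
  case (Suc n)
  have "resolvable K (J n)" using Suc.prems by (intro small_set_resolvable) auto
  then obtain K1 c \<S> where K1: "K \<le> K1" and \<S>: "unit_family K K1 \<S>"
    and c: "\<And>k. K \<le> k \<Longrightarrow> k < K1 \<Longrightarrow> {c k} \<in> \<S> \<and> \<rho> ^ (2 * k) < real (c k) \<and> real (c k) \<le> \<rho> ^ (2 * k + 2)"
    and Jn: "\<And>\<theta>. \<theta> \<in> J n \<Longrightarrow> \<exists>S\<in>\<S>. dist_far \<theta> S"
    unfolding resolvable_def by blast
  define J' where "J' i = J i \<inter> (\<Inter>k\<in>{K..<K1}. {\<theta>. int_dist (real (c k) * \<theta>) \<le> eps})" for i
  have J': "compact (J' i) \<and> J' i \<inter> \<int> = {} \<and> (\<forall>x\<in>J' i. \<forall>y\<in>J' i. \<bar>x - y\<bar> \<le> track_width K1)" if i: "i < n" for i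
  proof (intro conjI ballI)
    have Ji: "compact (J i)" "J i \<inter> \<int> = {}" "\<And>x y. x \<in> J i \<Longrightarrow> y \<in> J i \<Longrightarrow> \<bar>x - y\<bar> \<le> track_width K"
      using Suc.prems(2)[of i] i by auto
    show "compact (J' i)" unfolding J'_def using Ji(1)
      by (intro compact_Int_closed closed_INT ballI closed_Collect_le continuous_intros)
    show "J' i \<inter> \<int> = {}" using Ji(2) by (auto simp: J'_def)
    show "\<bar>x - y\<bar> \<le> track_width K1" if "x \<in> J' i" "y \<in> J' i" for x y
      by (rule survivors_close[of K K1 c]) (use c K1 that Ji(3) in \<open>auto simp: J'_def\<close>)
  qed
  have "K0 \<le> K1" using K1 Suc.prems(1) by simp
  have "\<exists>K' \<T>. K1 \<le> K' \<and> unit_family K1 K' \<T> \<and> (\<forall>i<n. \<forall>\<theta>\<in>J' i. \<exists>S\<in>\<T>. dist_far \<theta> S)"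
    by (rule Suc.IH[OF \<open>K0 \<le> K1\<close>]) (rule J')
  then obtain K2 \<T> where \<T>: "K1 \<le> K2" "unit_family K1 K2 \<T>"
    "\<And>i \<theta>. i < n \<Longrightarrow> \<theta> \<in> J' i \<Longrightarrow> \<exists>S\<in>\<T>. dist_far \<theta> S" by blast
  have "\<exists>S\<in>\<S> \<union> \<T>. dist_far \<theta> S" if i: "i < Suc n" and \<theta>: "\<theta> \<in> J i" for i \<theta>
  proof (cases "i = n")
    case True
    then show ?thesis using Jn \<theta> by blast
  next
    case False
    show ?thesis
    proof (cases "\<theta> \<in> J' i")
      case True
      then show ?thesis using \<T>(3)[of i \<theta>] i False by auto
    next
      case False
      then obtain k where k: "K \<le> k" "k < K1" "\<not> int_dist (real (c k) * \<theta>) \<le> eps"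
        using \<theta> unfolding J'_def by auto
      then have "dist_far \<theta> {c k}" by (simp add: dist_far_def)
      then show ?thesis using c[OF k(1,2)] by blast
    qed
  qed
  then show ?case using unit_family_Un(1)[OF \<S> \<T>(2) K1 \<T>(1)] K1 \<T>(1) by (meson le_trans)
qed

lemma interval_resolvable:
  assumes "K0 \<le> K" "0 < \<eta>"
  shows "\<exists>K' \<S>. K \<le> K' \<and> unit_family K K' \<S> \<and> (\<forall>\<theta>\<in>{\<eta>..1 - \<eta>}. \<exists>S\<in>\<S>. dist_far \<theta> S)"
proof -
  define J where "J i = {\<eta> + real i * track_width K .. \<eta> + real (Suc i) * track_width K} \<inter> {\<eta>..1 - \<eta>}" for i
  obtain n where n: "1 < real n * track_width K" using reals_Archimedean3[OF track_width_pos] by blast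
  have "J i \<inter> \<int> = {}" for i
  proof -
    have False if x: "x \<in> \<int>" "\<eta> \<le> x" "x \<le> 1 - \<eta>" for x
    proof -
      obtain z :: int where z: "x = of_int z" using x(1) by (rule Ints_cases)
      then have "0 < z" "z < 1" using x(2,3) assms(2) by linarith+
      then show False by simp
    qed
    then show ?thesis by (force simp: J_def)
  qed
  then have J: "compact (J i) \<and> J i \<inter> \<int> = {} \<and> (\<forall>x\<in>J i. \<forall>y\<in>J i. \<bar>x - y\<bar> \<le> track_width K)" for i
    by (intro conjI ballI) (auto simp: J_def compact_Int algebra_simps abs_le_iff)
  have "\<exists>K' \<S>. K \<le> K' \<and> unit_family K K' \<S> \<and> (\<forall>i<n. \<forall>\<theta>\<in>J i. \<exists>S\<in>\<S>. dist_far \<theta> S)"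
    by (rule finitely_many_small_sets_resolvable[OF assms(1)]) (rule J)
  then obtain K' \<S> where S: "K \<le> K'" "unit_family K K' \<S>" "\<And>i \<theta>. i < n \<Longrightarrow> \<theta> \<in> J i \<Longrightarrow> \<exists>S\<in>\<S>. dist_far \<theta> S"
    by blast
  have "\<exists>i<n. \<theta> \<in> J i" if "\<theta> \<in> {\<eta>..1 - \<eta>}" for \<theta>
  proof -
    define i where "i = nat \<lfloor>(\<theta> - \<eta>) / track_width K\<rfloor>"
    have q: "0 \<le> (\<theta> - \<eta>) / track_width K" using that track_width_pos[of K] by simp
    then have i: "real i \<le> (\<theta> - \<eta>) / track_width K" "(\<theta> - \<eta>) / track_width K < real (Suc i)"
      unfolding i_def by linarith+
    then have i': "real i * track_width K \<le> \<theta> - \<eta>" "\<theta> - \<eta> < real (Suc i) * track_width K"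
      using track_width_pos[of K] by (simp_all only: pos_le_divide_eq pos_divide_less_eq)
    have "real i * track_width K < real n * track_width K" using i'(1) n that assms(2) by auto
    then have "i < n" using track_width_pos[of K] by simp
    moreover have "\<theta> \<in> J i" using i' that by (auto simp: J_def)
    ultimately show ?thesis by blast
  qed
  with S show ?thesis by blast
qed

text \<open>
A unit whose sum is far from the integers at \<open>\<theta>\<close> contributes a factor at most \<open>cos (pi * eps)\<close>, and all other factors are
at most \<open>1\<close>. Repeating the construction \<open>r\<close> times in later and later levels gives \<open>r\<close> such factors.
\<close>
lemma cosine_product_small:
  assumes "K0 \<le> K" "0 < \<eta>"
  shows "\<exists>K' \<S>. K \<le> K' \<and> unit_family K K' \<S> \<and>
           (\<forall>\<theta>\<in>{\<eta>..1 - \<eta>}. (\<Prod>S\<in>\<S>. \<bar>cos (pi * (real (\<Sum>S) * \<theta>))\<bar>) \<le> cos (pi * eps) ^ r)"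
proof (induction r)
  case 0
  have "unit_family K K {}" by (simp add: unit_family_def block_monochromatic_def)
  then show ?case by (intro exI[of _ K] exI[of _ "{}"]) auto
next
  case (Suc r)
  define f where "f \<theta> S = \<bar>cos (pi * (real (\<Sum>S) * \<theta>))\<bar>" for \<theta> S
  have f: "0 \<le> f \<theta> S" "f \<theta> S \<le> 1" for \<theta> S by (auto simp: f_def)
  from Suc obtain K1 \<S> where S: "K \<le> K1" "unit_family K K1 \<S>"
    "\<And>\<theta>. \<theta> \<in> {\<eta>..1 - \<eta>} \<Longrightarrow> prod (f \<theta>) \<S> \<le> cos (pi * eps) ^ r" unfolding f_def by blast
  have "K0 \<le> K1" using S(1) assms(1) by simp
  from interval_resolvable[OF this assms(2)] obtain K2 \<T> where T: "K1 \<le> K2" "unit_family K1 K2 \<T>"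
    "\<And>\<theta>. \<theta> \<in> {\<eta>..1 - \<eta>} \<Longrightarrow> \<exists>S\<in>\<T>. dist_far \<theta> S" by blast
  have U: "unit_family K K2 (\<S> \<union> \<T>)" "\<S> \<inter> \<T> = {}" using unit_family_Un[OF S(2) T(2) S(1) T(1)] by auto
  have fin: "finite \<S>" "finite \<T>" using S(2) T(2) by (auto simp: unit_family_def)
  have "prod (f \<theta>) (\<S> \<union> \<T>) \<le> cos (pi * eps) ^ Suc r" if \<theta>: "\<theta> \<in> {\<eta>..1 - \<eta>}" for \<theta>
  proof -
    obtain V where V: "V \<in> \<T>" "dist_far \<theta> V" using T(3)[OF \<theta>] by blast
    have "prod (f \<theta>) \<T> = f \<theta> V * prod (f \<theta>) (\<T> - {V})" using fin V by (simp add: prod.remove)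
    also have "\<dots> \<le> f \<theta> V" using f by (intro mult_left_le prod_le_1) auto
    also have "\<dots> \<le> cos (pi * eps)"
      unfolding f_def using V(2) eps_pos by (intro abs_cos_pi_le) (auto simp: dist_far_def)
    finally have "prod (f \<theta>) \<T> \<le> cos (pi * eps)" .
    moreover have "0 \<le> prod (f \<theta>) \<S>" "0 \<le> prod (f \<theta>) \<T>" using f by (auto intro: prod_nonneg)
    ultimately have "prod (f \<theta>) \<S> * prod (f \<theta>) \<T> \<le> cos (pi * eps) ^ r * cos (pi * eps)"
      using S(3)[OF \<theta>] by (intro mult_mono) auto
    then show ?thesis using fin U(2) by (simp add: prod.union_disjoint mult.commute)
  qed
  then show ?case using U(1) S(1) T(1) unfolding f_def by (meson le_trans)
qed

text \<open>
The exponential sum over all unions of units factors as the product of \<open>1 + circle_char (\<Sum>S * \<theta>)\<close> over the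
units \<open>S\<close>, whose moduli are twice the cosines of the preceding lemma.
\<close>
lemma exists_equidistributed_units:
  assumes "0 < \<eta>" "0 < \<delta>"
  obtains \<S> where "finite \<S>" "\<And>S. S \<in> \<S> \<Longrightarrow> finite S \<and> S \<subseteq> A" "block_monochromatic \<rho> A col (\<Union>\<S>)"
    "\<And>\<theta>. \<eta> \<le> \<theta> \<Longrightarrow> \<theta> \<le> 1 - \<eta> \<Longrightarrow> norm (exp_sum (Pow \<S>) (\<lambda>\<T>. \<Sum>(\<Union>\<T>)) \<theta>) \<le> \<delta> * real (card (Pow \<S>))"
proof -
  have "pi * eps \<le> pi" "0 < pi * eps" using eps_pos eps_less(2) by auto
  then have "cos (pi * eps) < 1" using cos_monotone_0_pi[of 0 "pi * eps"] by simp
  then obtain r where "cos (pi * eps) ^ r < \<delta>" using assms(2) real_arch_pow_inv by blast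
  then obtain K' \<S> where S: "unit_family K0 K' \<S>"
    "\<And>\<theta>. \<theta> \<in> {\<eta>..1 - \<eta>} \<Longrightarrow> (\<Prod>S\<in>\<S>. \<bar>cos (pi * (real (\<Sum>S) * \<theta>))\<bar>) \<le> \<delta>"
    using cosine_product_small[OF order_refl assms(1), of r] by (meson less_imp_le order_trans)
  have fin: "finite \<S>" and finS: "\<And>S. S \<in> \<S> \<Longrightarrow> finite S" and disj: "\<And>S T. S \<in> \<S> \<Longrightarrow> T \<in> \<S> \<Longrightarrow> S \<noteq> T \<Longrightarrow> S \<inter> T = {}"
    using S(1) by (auto simp: unit_family_def)
  have "norm (exp_sum (Pow \<S>) (\<lambda>\<T>. \<Sum>(\<Union>\<T>)) \<theta>) \<le> \<delta> * real (card (Pow \<S>))" if "\<eta> \<le> \<theta>" "\<theta> \<le> 1 - \<eta>" for \<theta>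
  proof -
    have char: "circle_char (real (\<Sum>(\<Union>\<T>)) * \<theta>) = (\<Prod>S\<in>\<T>. circle_char (real (\<Sum>S) * \<theta>))" if "\<T> \<subseteq> \<S>" for \<T>
    proof -
      have "\<forall>S\<in>\<T>. finite S" "\<forall>S\<in>\<T>. \<forall>T\<in>\<T>. S \<noteq> T \<longrightarrow> S \<inter> T = {}"
        using that finS disj by (blast, meson subsetD)
      then have "\<Sum>(\<Union>\<T>) = (\<Sum>S\<in>\<T>. \<Sum>S)"
        by (subst sum.Union_disjoint) (simp_all add: o_def)
      moreover have "finite \<T>" using that fin finite_subset by blast
      then have "circle_char (real (\<Sum>S\<in>\<T>. \<Sum>S) * \<theta>) = (\<Prod>S\<in>\<T>. circle_char (real (\<Sum>S) * \<theta>))"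
        by (induction \<T> rule: finite_induct) (simp_all add: distrib_right circle_char_add)
      ultimately show ?thesis by simp
    qed
    have "exp_sum (Pow \<S>) (\<lambda>\<T>. \<Sum>(\<Union>\<T>)) \<theta> = (\<Sum>\<T>\<in>Pow \<S>. \<Prod>S\<in>\<T>. circle_char (real (\<Sum>S) * \<theta>))"
      unfolding exp_sum_def by (intro sum.cong refl char) auto
    also have "\<dots> = (\<Prod>S\<in>\<S>. circle_char (real (\<Sum>S) * \<theta>) + 1)"
      using prod_add[OF fin, of "\<lambda>S. circle_char (real (\<Sum>S) * \<theta>)" "\<lambda>_. 1"] by simp
    finally have "norm (exp_sum (Pow \<S>) (\<lambda>\<T>. \<Sum>(\<Union>\<T>)) \<theta>) = (\<Prod>S\<in>\<S>. 2 * \<bar>cos (pi * (real (\<Sum>S) * \<theta>))\<bar>)"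
      by (simp only: prod_norm[symmetric] add.commute[of _ 1] norm_1_plus_circle_char)
    also have "\<dots> = 2 ^ card \<S> * (\<Prod>S\<in>\<S>. \<bar>cos (pi * (real (\<Sum>S) * \<theta>))\<bar>)"
      by (simp only: prod.distrib prod_constant)
    also have "\<dots> \<le> 2 ^ card \<S> * \<delta>" using S(2)[of \<theta>] that by (intro mult_left_mono) auto
    finally show ?thesis using fin by (simp add: card_Pow mult.commute)
  qed
  moreover have "S \<subseteq> A" if "S \<in> \<S>" for S
    using S(1) that by (auto simp: unit_family_def)
  moreover have "block_monochromatic \<rho> A col (\<Union>\<S>)" using S(1) by (simp add: unit_family_def)
  ultimately show thesis using that[of \<S>] fin finS by blast
qed

end

section \<open>Counting representations\<close>

lemma not_summable_if_infsum_ennreal_infinite: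
  assumes "(\<Sum>\<^sub>\<infinity>a\<in>A. ennreal (f a)) = \<infinity>" "\<And>a. a \<in> A \<Longrightarrow> 0 \<le> f a"
  shows "\<not> f summable_on A"
proof
  assume sum: "f summable_on A"
  have "(\<Sum>\<^sub>\<infinity>a\<in>A. ennreal (f a)) = (SUP F\<in>{F. finite F \<and> F \<subseteq> A}. \<Sum>a\<in>F. ennreal (f a))"
    by (rule nonneg_infsum_complete) simp
  also have "\<dots> = (SUP F\<in>{F. finite F \<and> F \<subseteq> A}. ennreal (sum f F))"
    using assms(2) by (intro SUP_cong refl sum_ennreal) auto
  also have "\<dots> = ennreal (infsum f A)"
    using infsum_nonneg_is_SUPREMUM_ennreal[OF sum assms(2)] by simp
  finally show False using assms(1) by simp
qed

lemma three_disjoint_subsets: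
  assumes "finite B" "a + b + c \<le> card B"
  shows "\<exists>X Y W. X \<subseteq> B \<and> Y \<subseteq> B \<and> W \<subseteq> B \<and> X \<inter> Y = {} \<and> X \<inter> W = {} \<and> Y \<inter> W = {} \<and>
           card X = a \<and> card Y = b \<and> card W = c"
proof -
  obtain X where X: "X \<subseteq> B" "card X = a" using obtain_subset_with_card_n[of a B] assms(2) by auto
  have "card (B - X) = card B - a" using X assms(1) by (simp add: card_Diff_subset finite_subset)
  then have "b \<le> card (B - X)" using assms(2) by simp
  then obtain Y where Y: "Y \<subseteq> B - X" "card Y = b" by (metis obtain_subset_with_card_n)
  have "card (B - X - Y) = card B - a - b"
    using X Y assms(1) \<open>card (B - X) = card B - a\<close> by (simp add: card_Diff_subset finite_subset)
  then have "c \<le> card (B - X - Y)" using assms(2) by simp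
  then obtain W where "W \<subseteq> B - X - Y" "card W = c" by (metis obtain_subset_with_card_n)
  with X Y show ?thesis by (intro exI[of _ X] exI[of _ Y] exI[of _ W]) auto
qed

text \<open>
Every \<open>V \<subseteq> W\<close> is completed to a representation of \<open>n\<close> by elements of \<open>Z\<close>, and \<open>V\<close> can be recovered from
the result by intersecting with \<open>W\<close>.
\<close>
lemma rep_count_ge_power:
  assumes "0 \<notin> A" "Z \<subseteq> A" "W \<subseteq> A" "finite W" "Z \<inter> W = {}"
    and rep: "\<And>n. n0 \<le> n \<Longrightarrow> \<exists>S\<subseteq>Z. finite S \<and> \<Sum>S = n"
    and n: "n0 + \<Sum>W \<le> n"
  shows "2 ^ card W \<le> rep_count A n"
proof -
  have "\<exists>S\<subseteq>Z. finite S \<and> \<Sum>S = n - \<Sum>V" if "V \<in> Pow W" for V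
  proof -
    have "\<Sum>V \<le> \<Sum>W" using that assms(4) by (intro sum_mono2) auto
    then show ?thesis using n by (intro rep) simp
  qed
  then obtain S where S: "\<And>V. V \<in> Pow W \<Longrightarrow> S V \<subseteq> Z \<and> finite (S V) \<and> \<Sum>(S V) = n - \<Sum>V" by metis
  define R where "R = {S. S \<subseteq> A \<and> finite S \<and> \<Sum>S = n}"
  have "finite R"
  proof (rule finite_subset)
    show "R \<subseteq> Pow {..n}"
    proof safe
      fix T a assume "T \<in> R" "a \<in> T"
      then show "a \<le> n" using member_le_sum[of a T "\<lambda>x. x"] by (auto simp: R_def)
    qed
  qed simp
  moreover have "inj_on (\<lambda>V. V \<union> S V) (Pow W)"
  proof (rule inj_onI)
    fix U V assume UV: "U \<in> Pow W" "V \<in> Pow W" "U \<union> S U = V \<union> S V"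
    have "T = (T \<union> S T) \<inter> W" if "T \<in> Pow W" for T using S[OF that] that assms(5) by auto
    then show "U = V" using UV by metis
  qed
  moreover have "(\<lambda>V. V \<union> S V) ` Pow W \<subseteq> R"
  proof safe
    fix V assume V: "V \<subseteq> W"
    then have SV: "S V \<subseteq> Z" "finite (S V)" "\<Sum>(S V) = n - \<Sum>V" "finite V"
      using S[of V] assms(4) finite_subset by auto
    have "\<Sum>V \<le> \<Sum>W" using V assms(4) by (intro sum_mono2) auto
    moreover have "\<Sum>(V \<union> S V) = \<Sum>V + \<Sum>(S V)"
      using SV V assms(5) by (intro sum.union_disjoint) auto
    ultimately have "\<Sum>(V \<union> S V) = n" using SV n by simp
    then show "V \<union> S V \<in> R" using SV V assms(2,3) by (auto simp: R_def)
  qed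
  ultimately have "card (Pow W) \<le> card R" by (metis card_inj_on_le)
  then show ?thesis using assms(4) by (simp add: card_Pow R_def rep_count_def)
qed

text \<open>
Choosing \<open>t\<close> as the integer part of \<open>log \<rho> (n / (2 * C))\<close> makes the bound at least a constant multiple of
\<open>n powr ((d + 1) * log \<rho> 2)\<close>; the surplus \<open>n powr log \<rho> 2\<close> tends to infinity.
\<close>
lemma growth_from_power_of_two_bound:
  fixes r :: "nat \<Rightarrow> nat" and \<rho> C :: real
  assumes "\<rho> > 1" "C > 0"
    and bound: "\<And>n t. K1 \<le> t \<Longrightarrow> real n0 + C * \<rho> ^ t \<le> real n \<Longrightarrow> 2 ^ ((d + 1) * (t - K1)) \<le> r n"
  shows "filterlim (\<lambda>n. real (r n) / real n powr (real d * log \<rho> 2)) at_top sequentially"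
proof -
  define c where "c = real (d + 1) * (log \<rho> (2 * C) + 1 + real K1)"
  have "filterlim (\<lambda>n. exp (ln 2 * (- c + (1 / ln \<rho>) * ln (real n)))) at_top sequentially"
    using assms(1)
    by (intro filterlim_compose[OF exp_at_top] filterlim_tendsto_pos_mult_at_top[OF tendsto_const]
         filterlim_tendsto_add_at_top[OF tendsto_const] filterlim_compose[OF ln_at_top] filterlim_real_sequentially) auto
  moreover have "\<forall>\<^sub>F n in sequentially. exp (ln 2 * (- c + (1 / ln \<rho>) * ln (real n))) \<le> real (r n) / real n powr (real d * log \<rho> 2)"
  proof -
    define n1 where "n1 = max (2 * n0 + 1) (nat \<lceil>2 * C * \<rho> ^ (K1 + 1)\<rceil>)"
    have "exp (ln 2 * (- c + (1 / ln \<rho>) * ln (real n))) \<le> real (r n) / real n powr (real d * log \<rho> 2)" if n: "n1 \<le> n" for n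
    proof -
      have n0: "2 * real n0 + 1 \<le> real n" and nC: "2 * C * \<rho> ^ (K1 + 1) \<le> real n"
        using n unfolding n1_def by linarith+
      then have npos: "0 < real n" by linarith
      define l where "l = log \<rho> (real n / (2 * C))"
      have "\<rho> ^ (K1 + 1) \<le> real n / (2 * C)" using nC assms(2) by (simp add: field_simps)
      then have "log \<rho> (\<rho> ^ (K1 + 1)) \<le> l" unfolding l_def using assms(1,2) npos by (subst log_le_cancel_iff) auto
      moreover have "log \<rho> (\<rho> ^ (K1 + 1)) = real (K1 + 1)" using assms(1) by (subst log_nat_power) auto
      ultimately have l: "real K1 + 1 \<le> l" by linarith
      define t where "t = nat \<lfloor>l\<rfloor>"
      have t: "real t \<le> l" "l - 1 < real t" "K1 \<le> t" using l unfolding t_def by linarith+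
      have "\<rho> ^ t = \<rho> powr real t" using assms(1) by (simp add: powr_realpow)
      also have "\<dots> \<le> \<rho> powr l" using t(1) assms(1) by simp
      also have "\<dots> = real n / (2 * C)" unfolding l_def using assms(1,2) npos by simp
      finally have "C * \<rho> ^ t \<le> real n / 2" using assms(2) by (simp add: field_simps)
      then have "real n0 + C * \<rho> ^ t \<le> real n" using n0 by linarith
      then have "2 ^ ((d + 1) * (t - K1)) \<le> r n" by (rule bound[OF t(3)])
      then have rn: "2 ^ ((d + 1) * (t - K1)) \<le> real (r n)" by (metis of_nat_le_iff of_nat_numeral of_nat_power)
      have log: "l = log \<rho> (real n) - log \<rho> (2 * C)" unfolding l_def using assms(1,2) npos by (simp add: log_divide)
      have "real (d + 1) * (log \<rho> (real n) - log \<rho> (2 * C) - 1 - real K1) \<le> real (d + 1) * (real t - real K1)"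
        using t log by (intro mult_left_mono) auto
      then have "(- c + log \<rho> (real n)) + real d * log \<rho> (real n) \<le> real ((d + 1) * (t - K1))"
        unfolding of_nat_mult of_nat_diff[OF t(3)] c_def by (simp add: algebra_simps)
      then have "2 powr ((- c + log \<rho> (real n)) + real d * log \<rho> (real n)) \<le> 2 powr real ((d + 1) * (t - K1))"
        by simp
      also have "\<dots> = 2 ^ ((d + 1) * (t - K1))" by (rule powr_realpow) simp
      also have "\<dots> \<le> real (r n)" by (rule rn)
      finally have main: "2 powr (- c + log \<rho> (real n)) * 2 powr (real d * log \<rho> (real n)) \<le> real (r n)"
        by (simp add: powr_add)
      have "real n powr (real d * log \<rho> 2) = 2 powr (real d * log \<rho> (real n))"
        using npos by (simp add: powr_def log_def)
      moreover have "exp (ln 2 * (- c + (1 / ln \<rho>) * ln (real n))) = 2 powr (- c + log \<rho> (real n))"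
        by (simp add: powr_def log_def mult.commute)
      ultimately show ?thesis using main by (simp add: pos_le_divide_eq)
    qed
    then show ?thesis unfolding eventually_sequentially by blast
  qed
  ultimately show ?thesis by (rule filterlim_at_top_mono)
qed

text \<open>
An element lies in only one block, so the colourings of the single blocks fit together.
\<close>
lemma exists_block_colouring:
  assumes "\<rho> > 1" "0 < m" "\<And>k. k1 \<le> k \<Longrightarrow> m \<le> card (block \<rho> A k)"
  obtains col :: "nat \<Rightarrow> nat" where "\<And>a. col a < m" "\<And>k. k1 \<le> k \<Longrightarrow> col ` block \<rho> A k = {..<m}"
proof -
  have "\<exists>f :: nat \<Rightarrow> nat. f ` block \<rho> A k = {..<m} \<and> (\<forall>a. f a < m)" if k: "k1 \<le> k" for k
  proof -
    obtain B where B: "B \<subseteq> block \<rho> A k" "card B = m" "finite B"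
      using obtain_subset_with_card_n[OF assms(3)[OF k]] by metis
    then obtain h where h: "bij_betw h B {..<m}" by (metis finite_same_card_bij finite_lessThan card_lessThan)
    define f where "f a = (if a \<in> B then h a else 0)" for a
    have "f a < m" for a using h assms(2) by (auto simp: f_def bij_betw_def)
    moreover have "{..<m} \<subseteq> f ` block \<rho> A k"
    proof
      fix j assume "j \<in> {..<m}"
      then have "j \<in> h ` B" using h by (simp add: bij_betw_def)
      then obtain b where "b \<in> B" "h b = j" by blast
      then show "j \<in> f ` block \<rho> A k" using B(1) by (intro image_eqI[of _ _ b]) (auto simp: f_def)
    qed
    ultimately show ?thesis by (intro exI[of _ f]) auto
  qed
  then obtain f :: "nat \<Rightarrow> nat \<Rightarrow> nat" where f: "\<And>k. k1 \<le> k \<Longrightarrow> f k ` block \<rho> A k = {..<m} \<and> (\<forall>a. f k a < m)"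
    by metis
  define idx where "idx a = (SOME k. a \<in> block \<rho> A k)" for a
  have idx: "idx a = k" if "a \<in> block \<rho> A k" for a k
    using someI[of "\<lambda>k. a \<in> block \<rho> A k", OF that] block_index_unique[OF assms(1) _ that] by (auto simp: idx_def)
  define col where "col a = (if k1 \<le> idx a then f (idx a) a else 0)" for a
  show thesis
  proof (rule that[of col])
    show "col a < m" for a using f assms(2) by (simp add: col_def)
    show "col ` block \<rho> A k = {..<m}" if "k1 \<le> k" for k
    proof -
      have "col ` block \<rho> A k = f k ` block \<rho> A k"
        using that by (intro image_cong) (auto simp: col_def idx)
      then show ?thesis using f[OF that] by simp
    qed
  qed
qed

lemma card_block_minus_monochromatic:
  assumes "block_monochromatic \<rho> A col F" "col ` block \<rho> A k = {..<m}"
  shows "m - 1 \<le> card (block \<rho> A k - F)"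
proof -
  have "\<exists>j. \<forall>a\<in>F \<inter> block \<rho> A k. col a = j" using assms(1) unfolding block_monochromatic_def by metis
  then obtain j where j: "\<And>a. a \<in> F \<Longrightarrow> a \<in> block \<rho> A k \<Longrightarrow> col a = j" by blast
  have "{..<m} - {j} \<subseteq> col ` (block \<rho> A k - F)" unfolding assms(2)[symmetric] using j by blast
  then have "card ({..<m} - {j}) \<le> card (col ` (block \<rho> A k - F))"
    by (intro card_mono) (auto simp: finite_block)
  also have "\<dots> \<le> card (block \<rho> A k - F)" by (intro card_image_le) (simp add: finite_block)
  finally show ?thesis by (simp add: card_Diff_singleton_if split: if_splits)
qed

text \<open>
The order of the choices matters: \<open>L\<close> is fixed by the first block, then \<open>F\<close> is chosen for this \<open>L\<close>,
then \<open>X\<close>, \<open>Y\<close> and the spare elements \<open>W\<close> are taken from what \<open>F\<close> leaves. In the finitely many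
blocks that \<open>F\<close> may touch, at least \<open>M - 1\<close> elements remain, which is enough for \<open>X\<close> and \<open>Y\<close>; in all later
blocks there are \<open>d + 1\<close> further elements.
\<close>
lemma rep_count_growth:
  fixes \<rho> :: real and M :: int and A :: "nat set"
  assumes rho: "\<rho> > 1" and M: "M \<ge> M_const \<rho>" and zero: "0 \<notin> A"
    and div: "\<And>\<theta>. \<theta> \<notin> \<int> \<Longrightarrow> \<not> (\<lambda>a. int_dist (real a * \<theta>)) summable_on A"
    and cnt: "\<And>k. k1 \<le> k \<Longrightarrow> M \<le> int (card (block \<rho> A k))"
  shows "filterlim (\<lambda>n. real (rep_count A n) / real n powr (real_of_int (M - M_const \<rho>) * log \<rho> 2)) at_top sequentially"
proof -
  obtain p q where pq: "dense_pattern \<rho> p" "dense_pattern \<rho> q" "\<And>k. int (p k + q k) + 1 = M_const \<rho>"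
    using dense_pattern_exists[OF rho] by blast
  define d where "d = nat (M - M_const \<rho>)"
  define m where "m = nat M"
  have m: "p k + q k + (d + 1) = m" for k using pq(3)[of k] M by (simp add: m_def d_def)
  have "m > 0" using m[of 0] by simp
  have cnt': "m \<le> card (block \<rho> A k)" if "k1 \<le> k" for k using cnt[OF that] by (simp add: m_def)
  obtain col :: "nat \<Rightarrow> nat" where col: "\<And>a. col a < m" "\<And>k. k1 \<le> k \<Longrightarrow> col ` block \<rho> A k = {..<m}"
    using exists_block_colouring[OF rho \<open>m > 0\<close> cnt'] by blast
  interpret coloured_blocks \<rho> A col m k1
  proof
    show "block \<rho> A k \<noteq> {}" if "2 * k1 \<le> k" for k
      using cnt'[of k] that \<open>m > 0\<close> by auto
  qed (use rho col(1) div in auto)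
  define k0 where "k0 = 2 * k1"
  define L where "L = nat \<lceil>\<rho> ^ (k0 + 2)\<rceil>"
  have L: "\<rho> ^ (k0 + 2) \<le> real L" unfolding L_def by (rule real_nat_ceiling_ge)
  have "0 < real L" using rho_power_pos[of "k0 + 2"] L by linarith
  then have "0 < 1 / (32 * real L ^ 3)" "0 < 1 / (8 * (real L)\<^sup>2)" by auto
  then obtain \<S> where S: "finite \<S>" "\<And>S. S \<in> \<S> \<Longrightarrow> finite S \<and> S \<subseteq> A" "block_monochromatic \<rho> A col (\<Union>\<S>)"
    and small: "\<And>\<theta>. 1 / (32 * real L ^ 3) \<le> \<theta> \<Longrightarrow> \<theta> \<le> 1 - 1 / (32 * real L ^ 3) \<Longrightarrow>
      norm (exp_sum (Pow \<S>) (\<lambda>\<T>. \<Sum>(\<Union>\<T>)) \<theta>) \<le> 1 / (8 * (real L)\<^sup>2) * real (card (Pow \<S>))"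
    using exists_equidistributed_units by metis
  define F where "F = \<Union>\<S>"
  have F: "finite F" "F \<subseteq> A" using S(1,2) by (auto simp: F_def)
  obtain j0 where j0: "real (\<Sum>F) < \<rho> ^ j0" using real_arch_pow[OF rho] by blast
  define K1 where "K1 = max k0 j0"
  have F_far: "F \<inter> block \<rho> A k = {}" if "K1 \<le> k" for k
  proof -
    have "real a \<le> \<rho> ^ k" if "a \<in> F" for a
    proof -
      have "a \<le> \<Sum>F" using that F(1) by (intro member_le_sum) auto
      then have "real a \<le> real (\<Sum>F)" by (simp only: of_nat_le_iff)
      moreover have "\<rho> ^ j0 \<le> \<rho> ^ k" using \<open>K1 \<le> k\<close> by (intro rho_power_mono) (simp add: K1_def)
      ultimately show ?thesis using j0 by linarith
    qed
    then show ?thesis by (force simp: block_def)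
  qed
  have "\<exists>X Y W. X \<subseteq> block \<rho> A k - F \<and> Y \<subseteq> block \<rho> A k - F \<and> W \<subseteq> block \<rho> A k - F \<and>
      X \<inter> Y = {} \<and> X \<inter> W = {} \<and> Y \<inter> W = {} \<and>
      card X = p k \<and> card Y = q k \<and> card W = (if K1 \<le> k then d + 1 else 0)" if "k0 \<le> k" for k
  proof (rule three_disjoint_subsets)
    show "finite (block \<rho> A k - F)" by (simp add: finite_block)
    show "p k + q k + (if K1 \<le> k then d + 1 else 0) \<le> card (block \<rho> A k - F)"
    proof (cases "K1 \<le> k")
      case True
      then have "block \<rho> A k - F = block \<rho> A k" using F_far by blast
      then show ?thesis using True cnt'[of k] m[of k] that by (simp add: k0_def)
    next
      case False
      have "m - 1 \<le> card (block \<rho> A k - F)"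
        using S(3) col(2)[of k] that unfolding F_def
        by (intro card_block_minus_monochromatic) (auto simp: k0_def)
      then show ?thesis using False m[of k] by simp
    qed
  qed
  then obtain X Y W where XYW: "\<And>k. k0 \<le> k \<Longrightarrow> X k \<subseteq> block \<rho> A k - F \<and> Y k \<subseteq> block \<rho> A k - F \<and> W k \<subseteq> block \<rho> A k - F \<and>
      X k \<inter> Y k = {} \<and> X k \<inter> W k = {} \<and> Y k \<inter> W k = {} \<and>
      card (X k) = p k \<and> card (Y k) = q k \<and> card (W k) = (if K1 \<le> k then d + 1 else 0)"
    by metis
  have sub: "X k \<subseteq> block \<rho> A k" "Y k \<subseteq> block \<rho> A k" "W k \<subseteq> block \<rho> A k"
    and offF: "X k \<inter> F = {}" "Y k \<inter> F = {}" "W k \<inter> F = {}"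
    and disj: "X k \<inter> Y k = {}" "X k \<inter> W k = {}" "Y k \<inter> W k = {}"
    and cards: "card (X k) = p k" "card (Y k) = q k" "card (W k) = (if K1 \<le> k then d + 1 else 0)"
    if "k0 \<le> k" for k
    using XYW[OF that] by blast+
  have cov: "covers L (subset_sums (\<Union>k\<in>{k0..}. X k))"
    if X: "\<And>k. k0 \<le> k \<Longrightarrow> X k \<subseteq> block \<rho> A k \<and> card (X k) = p k" and p: "dense_pattern \<rho> p"
    for X :: "nat \<Rightarrow> nat set" and p
  proof (rule covers_subset_sums_of_blocks[OF rho])
    show finX: "finite (X k)" if "k0 \<le> k" for k using X[OF that] finite_block finite_subset by blast
    show memX: "\<rho> ^ k < real x \<and> real x \<le> \<rho> ^ (k + 1)" if "k0 \<le> k" "x \<in> X k" for k x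
      using X[OF that(1)] that(2) by (auto simp: block_def)
    show "\<rho> ^ (k + 1) \<le> (\<Sum>j=k0..<k. real (\<Sum>(X j))) + real L" if k: "k0 \<le> k" for k
    proof -
      have "real (p j) * \<rho> ^ j \<le> real (\<Sum>(X j))" if "k0 \<le> j" for j
      proof -
        have "(\<Sum>x\<in>X j. \<rho> ^ j) \<le> (\<Sum>x\<in>X j. real x)" using memX[OF that] by (intro sum_mono) force
        then show ?thesis using X[OF that] by simp
      qed
      then have "(\<Sum>j=k0..<k. real (p j) * \<rho> ^ j) \<le> (\<Sum>j=k0..<k. real (\<Sum>(X j)))"
        by (intro sum_mono) auto
      then show ?thesis using dense_pattern_sum[OF rho p k L] by linarith
    qed
  qed
  define XX where "XX = (\<Union>k\<in>{k0..}. X k)"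
  define YY where "YY = (\<Union>k\<in>{k0..}. Y k)"
  have covX: "covers L (subset_sums XX)" unfolding XX_def by (rule cov[OF _ pq(1)]) (simp add: sub cards)
  have covY: "covers L (subset_sums YY)" unfolding YY_def by (rule cov[OF _ pq(2)]) (simp add: sub cards)
  define Z where "Z = XX \<union> YY \<union> F"
  have same: "k = l" if "a \<in> block \<rho> A k" "a \<in> block \<rho> A l" for a k l
    using block_index_unique[OF rho that] .
  have XY: "XX \<inter> YY = {}" "XX \<inter> F = {}" "YY \<inter> F = {}"
  proof -
    show "XX \<inter> YY = {}"
    proof (rule ccontr)
      assume "XX \<inter> YY \<noteq> {}"
      then obtain a k l where kl: "k0 \<le> k" "k0 \<le> l" "a \<in> X k" "a \<in> Y l" by (auto simp: XX_def YY_def)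
      then have "a \<in> block \<rho> A k" "a \<in> block \<rho> A l" using sub by blast+
      then have "k = l" by (rule same)
      then show False using disj(1)[OF kl(1)] kl by blast
    qed
    show "XX \<inter> F = {}" "YY \<inter> F = {}" using offF unfolding XX_def YY_def by blast+
  qed
  define G where "G = \<Sum>F"
  define n0 where "n0 = 2 * (G + L)"
  have rep: "\<exists>S\<subseteq>Z. finite S \<and> \<Sum>S = n" if n: "n0 \<le> n" for n
  proof -
    have "\<exists>s1\<in>subset_sums XX. \<exists>s2\<in>subset_sums YY. \<exists>\<T>\<in>Pow \<S>. s1 + s2 + \<Sum>(\<Union>\<T>) = n"
    proof (rule ternary_circle_method[OF covX covY])
      show "\<Sum>(\<Union>\<T>) \<le> G" if "\<T> \<in> Pow \<S>" for \<T>
        unfolding G_def using that F(1) by (intro sum_mono2) (auto simp: F_def)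
    qed (use S(1) small n in \<open>auto simp: n0_def\<close>)
    then obtain U V \<T> where UV: "finite U" "U \<subseteq> XX" "finite V" "V \<subseteq> YY" "\<T> \<subseteq> \<S>" "\<Sum>U + \<Sum>V + \<Sum>(\<Union>\<T>) = n"
      by (auto simp: subset_sums_def)
    have "\<Union>\<T> \<subseteq> F" using UV(5) by (auto simp: F_def)
    then have T: "\<Union>\<T> \<subseteq> F" "finite (\<Union>\<T>)" using F(1) finite_subset by auto
    have "\<Sum>(U \<union> V) = \<Sum>U + \<Sum>V" using UV XY by (intro sum.union_disjoint) auto
    moreover have "\<Sum>(U \<union> V \<union> \<Union>\<T>) = \<Sum>(U \<union> V) + \<Sum>(\<Union>\<T>)"
    proof (rule sum.union_disjoint)
      show "(U \<union> V) \<inter> \<Union>\<T> = {}" using UV(2,4) XY(2,3) T(1) by blast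
    qed (use UV(1,3) T(2) in auto)
    ultimately have "\<Sum>(U \<union> V \<union> \<Union>\<T>) = n" using UV(6) by simp
    moreover have "U \<union> V \<union> \<Union>\<T> \<subseteq> Z" using UV(2,4) T(1) unfolding Z_def by blast
    moreover have "finite (U \<union> V \<union> \<Union>\<T>)" using UV(1,3) T(2) by blast
    ultimately show ?thesis by blast
  qed
  define C where "C = real (d + 1) * \<rho> / (\<rho> - 1)"
  have "C > 0" using rho by (simp add: C_def)
  have bound: "2 ^ ((d + 1) * (t - K1)) \<le> rep_count A n" if t: "K1 \<le> t" and n: "real n0 + C * \<rho> ^ t \<le> real n" for n t
  proof -
    define WW where "WW = (\<Union>k\<in>{K1..<t}. W k)"
    have k0: "k0 \<le> k" if "K1 \<le> k" for k using that by (simp add: K1_def)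
    have W: "W k \<subseteq> block \<rho> A k" "finite (W k)" "card (W k) = d + 1" if "K1 \<le> k" for k
      using sub(3)[OF k0[OF that]] cards(3)[OF k0[OF that]] that finite_subset[OF _ finite_block] by auto
    have disjW: "W k \<inter> W l = {}" if "K1 \<le> k" "K1 \<le> l" "k \<noteq> l" for k l
      using W(1)[OF that(1)] W(1)[OF that(2)] same that(3) by blast
    have cardW: "card WW = (d + 1) * (t - K1)"
    proof -
      have "card WW = (\<Sum>k\<in>{K1..<t}. card (W k))"
        unfolding WW_def using W(2) disjW by (intro card_UN_disjoint) auto
      also have "\<dots> = (\<Sum>k\<in>{K1..<t}. d + 1)" using W(3) by (intro sum.cong) auto
      finally show ?thesis by simp
    qed
    have "real (\<Sum>WW) = (\<Sum>k\<in>{K1..<t}. \<Sum>x\<in>W k. real x)"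
      unfolding WW_def of_nat_sum using W(2) disjW by (intro sum.UNION_disjoint) auto
    also have "\<dots> \<le> (\<Sum>k\<in>{K1..<t}. \<Sum>x\<in>W k. \<rho> ^ (k + 1))"
      using W(1) by (intro sum_mono) (force simp: block_def)
    also have "\<dots> = (\<Sum>k\<in>{K1..<t}. real (d + 1) * \<rho> ^ (k + 1))"
      using W(3) by (intro sum.cong refl) simp
    also have "\<dots> \<le> (\<Sum>k<t. real (d + 1) * \<rho> ^ (k + 1))"
      using rho by (intro sum_mono2) auto
    also have "\<dots> = real (d + 1) * \<rho> * (\<Sum>k<t. \<rho> ^ k)" by (simp add: sum_distrib_left mult.assoc)
    also have "\<dots> = real (d + 1) * \<rho> * ((\<rho> ^ t - 1) / (\<rho> - 1))" using rho by (simp add: geometric_sum)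
    also have "\<dots> = C * (\<rho> ^ t - 1)" by (simp add: C_def)
    also have "\<dots> \<le> C * \<rho> ^ t" using \<open>C > 0\<close> by (intro mult_left_mono) auto
    finally have "real (n0 + \<Sum>WW) \<le> real n" using n by simp
    then have "n0 + \<Sum>WW \<le> n" by (simp only: of_nat_le_iff)
    moreover have "Z \<inter> WW = {}"
    proof (rule ccontr)
      assume "Z \<inter> WW \<noteq> {}"
      then obtain a k where a: "a \<in> Z" "K1 \<le> k" "a \<in> W k" by (auto simp: WW_def)
      have "a \<notin> F" using offF(3)[OF k0[OF a(2)]] a(3) by blast
      then obtain l where l: "k0 \<le> l" "a \<in> X l \<union> Y l" using a(1) by (auto simp: Z_def XX_def YY_def)
      then have "a \<in> block \<rho> A l" "a \<in> block \<rho> A k" using sub[OF l(1)] W(1)[OF a(2)] a(3) by blast+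
      then have "l = k" by (rule same)
      then show False using disj(2,3)[OF l(1)] l(2) a(3) by blast
    qed
    moreover have "Z \<subseteq> A" "WW \<subseteq> A"
    proof -
      have blk: "block \<rho> A k \<subseteq> A" for k by (auto simp: block_def)
      have "XX \<subseteq> A" unfolding XX_def using sub(1) blk by (meson UN_least atLeast_iff order_trans)
      moreover have "YY \<subseteq> A" unfolding YY_def using sub(2) blk by (meson UN_least atLeast_iff order_trans)
      ultimately show "Z \<subseteq> A" unfolding Z_def using F(2) by simp
      show "WW \<subseteq> A" unfolding WW_def using W(1) blk by (meson UN_least atLeastLessThan_iff order_trans)
    qed
    moreover have "finite WW" using W(2) by (simp add: WW_def)
    ultimately have "2 ^ card WW \<le> rep_count A n" using zero rep by (intro rep_count_ge_power) auto
    then show ?thesis by (simp only: cardW)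
  qed
  have "real_of_int (M - M_const \<rho>) = real d" using M by (simp add: d_def)
  then show ?thesis using growth_from_power_of_two_bound[OF rho \<open>C > 0\<close> bound] by simp
qed

text \<open>
Removing a finite set \<open>F\<close> changes neither the late blocks nor the divergence of the sums, so
\<open>rep_count_growth\<close> applies to \<open>A - F\<close>. Completeness holds since the quotient is eventually positive.
\<close>
theorem theorem1p1:
  fixes \<rho> :: real and M :: int and A :: "nat set"
  assumes "\<rho> > 1"
    and "M \<ge> M_const \<rho>"
    and "0 \<notin> A"
    and "circle_divergent A"
    and "\<forall>\<^sub>F k::nat in sequentially.
           int (card {a \<in> A. real a \<in> {\<rho> ^ k <.. \<rho> ^ (k + 1)}}) \<ge> M"
  shows "(\<forall>F. F \<subseteq> A \<longrightarrow> finite F \<longrightarrow>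
            filterlim
              (\<lambda>n. real (rep_count (A - F) n) /
                    real n powr (real_of_int (M - M_const \<rho>) * log \<rho> 2))
              at_top sequentially)
         \<and> strongly_sum_complete A"
proof -
  have growth: "filterlim (\<lambda>n. real (rep_count (A - F) n) / real n powr (real_of_int (M - M_const \<rho>) * log \<rho> 2)) at_top sequentially"
    if F: "F \<subseteq> A" "finite F" for F
  proof -
    obtain k1 where k1: "\<And>k. k1 \<le> k \<Longrightarrow> int (card {a \<in> A. real a \<in> {\<rho> ^ k <.. \<rho> ^ (k + 1)}}) \<ge> M"
      using assms(5) unfolding eventually_sequentially by blast
    obtain k2 where k2: "real (\<Sum>F) < \<rho> ^ k2" using real_arch_pow[OF assms(1)] by blast
    have "M \<le> int (card (block \<rho> (A - F) k))" if k: "max k1 k2 \<le> k" for k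
    proof -
      have "real a \<le> \<rho> ^ k" if "a \<in> F" for a
      proof -
        have "a \<le> \<Sum>F" using that F(2) by (intro member_le_sum) auto
        then have "real a \<le> real (\<Sum>F)" by (simp only: of_nat_le_iff)
        moreover have "\<rho> ^ k2 \<le> \<rho> ^ k" using k assms(1) by (intro power_increasing) auto
        ultimately show ?thesis using k2 by linarith
      qed
      then have "block \<rho> (A - F) k = {a \<in> A. real a \<in> {\<rho> ^ k <.. \<rho> ^ (k + 1)}}"
        by (force simp: block_def)
      then show ?thesis using k1[of k] k by simp
    qed
    moreover have "\<not> (\<lambda>a. int_dist (real a * \<theta>)) summable_on A - F" if "\<theta> \<notin> \<int>" for \<theta>
    proof
      assume "(\<lambda>a. int_dist (real a * \<theta>)) summable_on A - F"
      then have "(\<lambda>a. int_dist (real a * \<theta>)) summable_on (A - F) \<union> F"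
        using F(2) by (intro summable_on_union) auto
      moreover have "(A - F) \<union> F = A" using F(1) by blast
      moreover have "\<not> (\<lambda>a. int_dist (real a * \<theta>)) summable_on A"
        using assms(4) that unfolding circle_divergent_def
        by (intro not_summable_if_infsum_ennreal_infinite) (auto simp: int_dist_nonneg)
      ultimately show False by simp
    qed
    ultimately show ?thesis
      using assms(1-3) by (intro rep_count_growth[where ?k1.0 = "max k1 k2"]) auto
  qed
  have "sum_complete (A - F)" if F: "F \<subseteq> A" "finite F" for F
  proof -
    have "\<forall>\<^sub>F n in sequentially. 0 < real (rep_count (A - F) n) / real n powr (real_of_int (M - M_const \<rho>) * log \<rho> 2)"
      using growth[OF F] unfolding filterlim_at_top_dense by blast
    then show ?thesis unfolding sum_complete_def
    proof eventually_elim
      case (elim n)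
      then have "0 < rep_count (A - F) n" by (auto simp: zero_less_divide_iff intro: Nat.gr0I)
      then have "{S. S \<subseteq> A - F \<and> finite S \<and> \<Sum>S = n} \<noteq> {}"
        unfolding rep_count_def by (metis card.empty less_irrefl)
      then show ?case by blast
    qed
  qed
  then show ?thesis using growth unfolding strongly_sum_complete_def by blast
qed

end
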